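(* Let $R$ be a commutative complete local Noetherian ring, let $\mathcal M$ be a class of Matlis-dualizable $R$-modules closed under taking submodules and quotient modules, and let $\alpha$ be a preradical on $\mathcal M^\vee$. Then the smile dual $\alpha^{\smile}$ (on $\mathcal M$) is hereditary if and only if $\alpha$ is cohereditary.
   Context: Let $E$ be the injective hull of the residue field of $R$ and $(-)^\vee=\operatorname{Hom}_R(-,E)$. A module $M$ is Matlis-dualizable if the natural map $M\to M^{\vee\vee}$ is an isomorphism; $M$ and $M^{\vee\vee}$ are identified. $\mathcal M$ is taken closed under isomorphism and $\mathcal M^\vee$ is the class of modules isomorphic to $M^\vee$ for some $M\in\mathcal M$. A preradical on a class $\mathcal C$ of modules (closed under submodules and quotients) is an assignment of a submodule $\alpha(M)\subseteq M$ to each $M\in\mathcal C$ with $g(\alpha(M))\subseteq\alpha(N)$ for every homomorphism $g:M\to N$ in $\mathcal C$. A preradical $\alpha$ is hereditary if $\alpha(L)=L\cap\alpha(M)$ for all $L\subseteq M$ in $\mathcal C$ (equivalently, $\alpha$ is left exact). It is cohereditary if $\pi(\alpha(M))=\alpha(N)$ for every surjection $\pi:M\to N$ in $\mathcal C$ (i.e. $\alpha$ preserves surjections). The smile dual of $\alpha$ is given by $\alpha^{\smile}(M):=(M^\vee/\alpha(M^\vee))^\vee$ for $M\in\mathcal M$, regarded as a submodule of $M\cong M^{\vee\vee}$ via the dual of the quotient map $M^\vee\to M^\vee/\alpha(M^\vee)$. *)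

theory Defs
  imports "HOL-Algebra.Ring_Divisibility" "HOL-Algebra.Ideal_Product" "HOL-Algebra.Module"
begin

section \<open>Modules: homomorphisms, quotients, duals\<close>

text \<open>Modules are records of type \<open>('r, 'm) module\<close>. The fields \<open>mult\<close> and \<open>one\<close>, which
  such a record inherits from rings, play no role; constructions below set them to
  \<open>undefined\<close>.\<close>

definition mod_hom ::
  "('r, 'z) ring_scheme \<Rightarrow> ('r, 'm) module \<Rightarrow> ('r, 'n) module \<Rightarrow> ('m \<Rightarrow> 'n) set" where
  "mod_hom R M N = {f. f \<in> carrier M \<rightarrow> carrier N \<and>
     (\<forall>x\<in>carrier M. \<forall>y\<in>carrier M. f (x \<oplus>\<^bsub>M\<^esub> y) = f x \<oplus>\<^bsub>N\<^esub> f y) \<and>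
     (\<forall>r\<in>carrier R. \<forall>x\<in>carrier M. f (r \<odot>\<^bsub>M\<^esub> x) = r \<odot>\<^bsub>N\<^esub> f x)}"

definition mod_iso ::
  "('r, 'z) ring_scheme \<Rightarrow> ('r, 'm) module \<Rightarrow> ('r, 'n) module \<Rightarrow> bool" where
  "mod_iso R M N \<longleftrightarrow> (\<exists>f\<in>mod_hom R M N. bij_betw f (carrier M) (carrier N))"

definition regular_module :: "('r, 'z) ring_scheme \<Rightarrow> ('r, 'r) module" where
  "regular_module R = \<lparr>carrier = carrier R, mult = undefined, one = undefined,
     zero = \<zero>\<^bsub>R\<^esub>, add = add R, smult = mult R\<rparr>"

definition quot_module ::
  "('r, 'z) ring_scheme \<Rightarrow> ('r, 'm) module \<Rightarrow> 'm set \<Rightarrow> ('r, 'm set) module" where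
  "quot_module R M H = \<lparr>carrier = a_rcosets\<^bsub>M\<^esub> H, mult = undefined, one = undefined,
     zero = H, add = set_add M,
     smult = (\<lambda>r X. \<Union>x\<in>X. H +>\<^bsub>M\<^esub> (r \<odot>\<^bsub>M\<^esub> x))\<rparr>"

text \<open>The module \<open>Hom\<^sub>R(M, E)\<close>. Its elements are made extensional so that two homomorphisms
  are equal iff they agree on the carrier of \<open>M\<close>.\<close>

definition dual ::
  "('r, 'z) ring_scheme \<Rightarrow> ('r, 'e) module \<Rightarrow> ('r, 'm) module \<Rightarrow> ('r, 'm \<Rightarrow> 'e) module" where
  "dual R E M = \<lparr>carrier = mod_hom R M E \<inter> extensional (carrier M),
     mult = undefined, one = undefined,
     zero = (\<lambda>x\<in>carrier M. \<zero>\<^bsub>E\<^esub>),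
     add = (\<lambda>f g. \<lambda>x\<in>carrier M. f x \<oplus>\<^bsub>E\<^esub> g x),
     smult = (\<lambda>r f. \<lambda>x\<in>carrier M. r \<odot>\<^bsub>E\<^esub> f x)\<rparr>"

text \<open>For \<open>h : M \<rightarrow> N\<close>, the dual map sends a homomorphism \<open>f : N \<rightarrow> E\<close> to \<open>f \<circ> h : M \<rightarrow> E\<close>.\<close>

definition dual_map :: "('r, 'm) module \<Rightarrow> ('m \<Rightarrow> 'n) \<Rightarrow> ('n \<Rightarrow> 'e) \<Rightarrow> ('m \<Rightarrow> 'e)" where
  "dual_map M h f = (\<lambda>x\<in>carrier M. f (h x))"

definition bidual_map ::
  "('r, 'z) ring_scheme \<Rightarrow> ('r, 'e) module \<Rightarrow> ('r, 'm) module \<Rightarrow> 'm \<Rightarrow> (('m \<Rightarrow> 'e) \<Rightarrow> 'e)" where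
  "bidual_map R E M x = (\<lambda>f\<in>carrier (dual R E M). f x)"

definition matlis_dualizable ::
  "('r, 'z) ring_scheme \<Rightarrow> ('r, 'e) module \<Rightarrow> ('r, 'm) module \<Rightarrow> bool" where
  "matlis_dualizable R E M \<longleftrightarrow>
     module R M \<and> bij_betw (bidual_map R E M) (carrier M) (carrier (dual R E (dual R E M)))"


section \<open>Complete local Noetherian rings\<close>

definition local_ring :: "('r, 'z) ring_scheme \<Rightarrow> bool" where
  "local_ring R \<longleftrightarrow> cring R \<and> (\<exists>!\<mm>. maximalideal \<mm> R)"

definition max_ideal :: "('r, 'z) ring_scheme \<Rightarrow> 'r set" where
  "max_ideal R = (THE \<mm>. maximalideal \<mm> R)"

primrec ideal_power :: "('r, 'z) ring_scheme \<Rightarrow> 'r set \<Rightarrow> nat \<Rightarrow> 'r set" where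
  "ideal_power R I 0 = carrier R"
| "ideal_power R I (Suc n) = ideal_prod R I (ideal_power R I n)"

text \<open>The canonical map from \<open>R\<close> to the inverse limit of the rings \<open>R/I\<^sup>n\<close> is bijective.
  An element of the inverse limit is a sequence of cosets; \<open>c (Suc n)\<close> is mapped
  to \<open>c n\<close> by \<open>R/I\<^sup>n\<^sup>+\<^sup>1 \<rightarrow> R/I\<^sup>n\<close> iff it is a subset of \<open>c n\<close>.\<close>

definition adically_complete :: "('r, 'z) ring_scheme \<Rightarrow> 'r set \<Rightarrow> bool" where
  "adically_complete R I \<longleftrightarrow>
     (\<forall>c. (\<forall>n. c n \<in> carrier (R Quot ideal_power R I n)) \<and> (\<forall>n. c (Suc n) \<subseteq> c n) \<longrightarrow>
        (\<exists>!r. r \<in> carrier R \<and> (\<forall>n. c n = ideal_power R I n +>\<^bsub>R\<^esub> r)))"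

definition complete_local_noetherian_ring :: "('r, 'z) ring_scheme \<Rightarrow> bool" where
  "complete_local_noetherian_ring R \<longleftrightarrow>
     noetherian_ring R \<and> local_ring R \<and> adically_complete R (max_ideal R)"


section \<open>Injective hulls\<close>

text \<open>A type cannot be quantified inside a definition, so the test modules \<open>A\<close> and \<open>B\<close> have
  carriers in the type of the ring. By Baer's criterion this is no restriction: theorem
  \<open>injective_module_extend\<close> below gives the extension property for \<open>A\<close> and \<open>B\<close> with carriers
  in arbitrary types.\<close>

definition injective_module :: "('r, 'z) ring_scheme \<Rightarrow> ('r, 'e) module \<Rightarrow> bool" where
  "injective_module R E \<longleftrightarrow> module R E \<and>
     (\<forall>(A :: ('r, 'r) module) (B :: ('r, 'r) module) i f.
        module R A \<and> module R B \<and> i \<in> mod_hom R A B \<and> inj_on i (carrier A) \<and> f \<in> mod_hom R A E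
        \<longrightarrow> (\<exists>g\<in>mod_hom R B E. \<forall>a\<in>carrier A. g (i a) = f a))"

definition injective_hull ::
  "('r, 'z) ring_scheme \<Rightarrow> ('r, 'k) module \<Rightarrow> ('r, 'e) module \<Rightarrow> bool" where
  "injective_hull R K E \<longleftrightarrow> injective_module R E \<and>
     (\<exists>j\<in>mod_hom R K E. inj_on j (carrier K) \<and>
        (\<forall>N. submodule N R E \<and> N \<inter> j ` carrier K = {\<zero>\<^bsub>E\<^esub>} \<longrightarrow> N = {\<zero>\<^bsub>E\<^esub>}))"

definition residue_field_module :: "('r, 'z) ring_scheme \<Rightarrow> ('r, 'r set) module" where
  "residue_field_module R = quot_module R (regular_module R) (max_ideal R)"


section \<open>Classes of modules\<close>

text \<open>The carriers of the modules in a class lie in one fixed, arbitrary type. A quotient \<open>M/H\<close>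
  has its carrier in another type, hence closure under quotients refers to the isomorphic
  copies of \<open>M/H\<close> over the type of the class; such copies always exist (choose a
  representative in each coset).\<close>

definition iso_closed :: "('r, 'z) ring_scheme \<Rightarrow> ('r, 'm) module set \<Rightarrow> bool" where
  "iso_closed R C \<longleftrightarrow> (\<forall>M\<in>C. \<forall>N. module R N \<and> mod_iso R M N \<longrightarrow> N \<in> C)"

definition submodule_closed :: "('r, 'z) ring_scheme \<Rightarrow> ('r, 'm) module set \<Rightarrow> bool" where
  "submodule_closed R C \<longleftrightarrow> (\<forall>M\<in>C. \<forall>H. submodule H R M \<longrightarrow> M\<lparr>carrier := H\<rparr> \<in> C)"

definition quotient_closed :: "('r, 'z) ring_scheme \<Rightarrow> ('r, 'm) module set \<Rightarrow> bool" where
  "quotient_closed R C \<longleftrightarrow>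
     (\<forall>M\<in>C. \<forall>H N. submodule H R M \<and> module R N \<and> mod_iso R (quot_module R M H) N \<longrightarrow> N \<in> C)"

definition dual_class ::
  "('r, 'z) ring_scheme \<Rightarrow> ('r, 'e) module \<Rightarrow> ('r, 'm) module set \<Rightarrow> ('r, 'm \<Rightarrow> 'e) module set" where
  "dual_class R E C = {N. module R N \<and> (\<exists>M\<in>C. mod_iso R (dual R E M) N)}"


section \<open>Preradicals\<close>

definition preradical ::
  "('r, 'z) ring_scheme \<Rightarrow> ('r, 'm) module set \<Rightarrow> (('r, 'm) module \<Rightarrow> 'm set) \<Rightarrow> bool" where
  "preradical R C \<alpha> \<longleftrightarrow> (\<forall>M\<in>C. submodule (\<alpha> M) R M) \<and>
     (\<forall>M\<in>C. \<forall>N\<in>C. \<forall>g\<in>mod_hom R M N. g ` \<alpha> M \<subseteq> \<alpha> N)"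

definition hereditary ::
  "('r, 'z) ring_scheme \<Rightarrow> ('r, 'm) module set \<Rightarrow> (('r, 'm) module \<Rightarrow> 'm set) \<Rightarrow> bool" where
  "hereditary R C \<alpha> \<longleftrightarrow> preradical R C \<alpha> \<and>
     (\<forall>M\<in>C. \<forall>L. submodule L R M \<and> M\<lparr>carrier := L\<rparr> \<in> C \<longrightarrow> \<alpha> (M\<lparr>carrier := L\<rparr>) = L \<inter> \<alpha> M)"

definition cohereditary ::
  "('r, 'z) ring_scheme \<Rightarrow> ('r, 'm) module set \<Rightarrow> (('r, 'm) module \<Rightarrow> 'm set) \<Rightarrow> bool" where
  "cohereditary R C \<alpha> \<longleftrightarrow> preradical R C \<alpha> \<and>
     (\<forall>M\<in>C. \<forall>N\<in>C. \<forall>\<pi>\<in>mod_hom R M N. \<pi> ` carrier M = carrier N \<longrightarrow> \<pi> ` \<alpha> M = \<alpha> N)"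

text \<open>\<open>(M\<^sup>\<or>/\<alpha>(M\<^sup>\<or>))\<^sup>\<or>\<close>, embedded into \<open>M\<^sup>\<or>\<^sup>\<or>\<close> by the dual of the quotient map and then pulled back
  to \<open>M\<close> along \<open>M \<rightarrow> M\<^sup>\<or>\<^sup>\<or>\<close>.\<close>

definition smile_dual ::
  "('r, 'z) ring_scheme \<Rightarrow> ('r, 'e) module \<Rightarrow> (('r, 'm \<Rightarrow> 'e) module \<Rightarrow> ('m \<Rightarrow> 'e) set) \<Rightarrow>
     ('r, 'm) module \<Rightarrow> 'm set" where
  "smile_dual R E \<alpha> M =
     (let D = dual R E M; Q = quot_module R D (\<alpha> D); q = (\<lambda>f. \<alpha> D +>\<^bsub>D\<^esub> f)
      in {x \<in> carrier M. bidual_map R E M x \<in> dual_map D q ` carrier (dual R E Q)})"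


section \<open>Baer's criterion\<close>

context
  fixes R :: "('r, 'z) ring_scheme" and B :: "('r, 'b) module" and E :: "('r, 'e) module"
begin

text \<open>Graphs of homomorphisms from submodules of \<open>B\<close> to \<open>E\<close>.\<close>

definition partial_hom_graphs :: "('b \<times> 'e) set set" where
  "partial_hom_graphs = {G. G \<subseteq> carrier B \<times> carrier E \<and>
     (\<forall>x y x' y'. (x, y) \<in> G \<longrightarrow> (x', y') \<in> G \<longrightarrow> (x \<oplus>\<^bsub>B\<^esub> x', y \<oplus>\<^bsub>E\<^esub> y') \<in> G) \<and>
     (\<forall>r x y. r \<in> carrier R \<longrightarrow> (x, y) \<in> G \<longrightarrow> (r \<odot>\<^bsub>B\<^esub> x, r \<odot>\<^bsub>E\<^esub> y) \<in> G) \<and>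
     (\<forall>y. (\<zero>\<^bsub>B\<^esub>, y) \<in> G \<longrightarrow> y = \<zero>\<^bsub>E\<^esub>)}"

lemma partial_hom_graphsD:
  assumes "G \<in> partial_hom_graphs"
  shows "(x, y) \<in> G \<Longrightarrow> x \<in> carrier B" "(x, y) \<in> G \<Longrightarrow> y \<in> carrier E"
    "(x, y) \<in> G \<Longrightarrow> (x', y') \<in> G \<Longrightarrow> (x \<oplus>\<^bsub>B\<^esub> x', y \<oplus>\<^bsub>E\<^esub> y') \<in> G"
    "r \<in> carrier R \<Longrightarrow> (x, y) \<in> G \<Longrightarrow> (r \<odot>\<^bsub>B\<^esub> x, r \<odot>\<^bsub>E\<^esub> y) \<in> G"
    "(\<zero>\<^bsub>B\<^esub>, y) \<in> G \<Longrightarrow> y = \<zero>\<^bsub>E\<^esub>"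
  using assms unfolding partial_hom_graphs_def by blast+

lemma partial_hom_graphs_neg:
  assumes "G \<in> partial_hom_graphs" "module R B" "module R E" "(x, y) \<in> G"
  shows "(\<ominus>\<^bsub>B\<^esub> x, \<ominus>\<^bsub>E\<^esub> y) \<in> G"
proof -
  interpret B: module R B by fact
  interpret E: module R E by fact
  have xy: "x \<in> carrier B" "y \<in> carrier E" using partial_hom_graphsD[OF assms(1)] assms(4) by auto
  have "((\<ominus>\<^bsub>R\<^esub> \<one>\<^bsub>R\<^esub>) \<odot>\<^bsub>B\<^esub> x, (\<ominus>\<^bsub>R\<^esub> \<one>\<^bsub>R\<^esub>) \<odot>\<^bsub>E\<^esub> y) \<in> G"
    using partial_hom_graphsD(4)[OF assms(1) _ assms(4)] by simp
  thus ?thesis using xy by (simp add: B.smult_l_minus E.smult_l_minus)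
qed

lemma partial_hom_graphs_unique:
  assumes "G \<in> partial_hom_graphs" "module R B" "module R E" "(x, y) \<in> G" "(x, y') \<in> G"
  shows "y = y'"
proof -
  interpret B: module R B by fact
  interpret E: module R E by fact
  note D = partial_hom_graphsD[OF assms(1)]
  have c: "x \<in> carrier B" "y \<in> carrier E" "y' \<in> carrier E" using D assms(4,5) by auto
  have "(x \<oplus>\<^bsub>B\<^esub> \<ominus>\<^bsub>B\<^esub> x, y \<oplus>\<^bsub>E\<^esub> \<ominus>\<^bsub>E\<^esub> y') \<in> G"
    by (rule D(3)[OF assms(4) partial_hom_graphs_neg[OF assms(1-3,5)]])
  hence "y \<oplus>\<^bsub>E\<^esub> \<ominus>\<^bsub>E\<^esub> y' = \<zero>\<^bsub>E\<^esub>" using D(5) c by (simp add: B.M.r_neg)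
  thus ?thesis using c by (metis E.M.minus_equality E.M.minus_minus E.M.a_inv_closed)
qed

lemma partial_hom_graphs_chain:
  assumes "\<C> \<noteq> {}" "subset.chain {G \<in> partial_hom_graphs. G0 \<subseteq> G} \<C>"
  shows "\<Union>\<C> \<in> {G \<in> partial_hom_graphs. G0 \<subseteq> G}"
proof -
  have sub: "\<And>G. G \<in> \<C> \<Longrightarrow> G \<in> partial_hom_graphs \<and> G0 \<subseteq> G"
    and ch: "\<And>G H. G \<in> \<C> \<Longrightarrow> H \<in> \<C> \<Longrightarrow> G \<subseteq> H \<or> H \<subseteq> G"
    using assms(2) by (auto simp: subset_chain_def)
  have "(x \<oplus>\<^bsub>B\<^esub> x', y \<oplus>\<^bsub>E\<^esub> y') \<in> \<Union>\<C>" if xy: "(x, y) \<in> \<Union>\<C>" "(x', y') \<in> \<Union>\<C>" for x y x' y'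
  proof -
    from xy obtain G H where GH: "G \<in> \<C>" "H \<in> \<C>" "(x, y) \<in> G" "(x', y') \<in> H" by auto
    then obtain K where "K \<in> \<C>" "(x, y) \<in> K" "(x', y') \<in> K" using ch[OF GH(1,2)] by blast
    thus ?thesis using sub partial_hom_graphsD(3) by (meson UnionI)
  qed
  moreover have "(r \<odot>\<^bsub>B\<^esub> x, r \<odot>\<^bsub>E\<^esub> y) \<in> \<Union>\<C>" if "r \<in> carrier R" "(x, y) \<in> \<Union>\<C>" for r x y
    using that sub partial_hom_graphsD(4) by (meson UnionE UnionI)
  moreover have "y = \<zero>\<^bsub>E\<^esub>" if "(\<zero>\<^bsub>B\<^esub>, y) \<in> \<Union>\<C>" for y
    using that sub partial_hom_graphsD(5) by (meson UnionE)
  moreover have "\<Union>\<C> \<subseteq> carrier B \<times> carrier E"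
    using sub partial_hom_graphsD(1,2) by (auto, blast+)
  moreover have "G0 \<subseteq> \<Union>\<C>" using sub assms(1) by blast
  ultimately show ?thesis unfolding partial_hom_graphs_def mem_Collect_eq by blast
qed

text \<open>The step of Baer's argument: a maximal graph is defined everywhere.\<close>

lemma partial_hom_graphs_step:
  assumes inj: "injective_module R E" and B: "module R B"
    and G: "G \<in> partial_hom_graphs" and G_ne: "(\<zero>\<^bsub>B\<^esub>, \<zero>\<^bsub>E\<^esub>) \<in> G" and b: "b \<in> carrier B"
  shows "\<exists>G' \<in> partial_hom_graphs. G \<subseteq> G' \<and> (\<exists>e. (b, e) \<in> G')"
proof -
  have E: "module R E" using inj by (simp add: injective_module_def)
  interpret B: module R B by fact
  interpret E: module R E by fact
  note D = partial_hom_graphsD[OF G]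
  define I where "I = {r \<in> carrier R. \<exists>y. (r \<odot>\<^bsub>B\<^esub> b, y) \<in> G}"
  define h where "h r = (THE y. (r \<odot>\<^bsub>B\<^esub> b, y) \<in> G)" for r
  have h_eq: "h r = y" if "(r \<odot>\<^bsub>B\<^esub> b, y) \<in> G" for r y
    unfolding h_def using that partial_hom_graphs_unique[OF G B E] by blast
  have h_in: "(r \<odot>\<^bsub>B\<^esub> b, h r) \<in> G" if "r \<in> I" for r
    using that h_eq unfolding I_def by auto
  have h_add: "(((r \<oplus>\<^bsub>R\<^esub> s) \<odot>\<^bsub>B\<^esub> b), h r \<oplus>\<^bsub>E\<^esub> h s) \<in> G" if "r \<in> I" "s \<in> I" for r s
    using D(3)[OF h_in[OF that(1)] h_in[OF that(2)]] that b by (simp add: B.smult_l_distr I_def)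
  have h_smult: "(((r \<otimes>\<^bsub>R\<^esub> s) \<odot>\<^bsub>B\<^esub> b), r \<odot>\<^bsub>E\<^esub> h s) \<in> G" if "r \<in> carrier R" "s \<in> I" for r s
    using D(4)[OF that(1) h_in[OF that(2)]] that b by (simp add: B.smult_assoc1 I_def)
  have reg: "module R (regular_module R)"
  proof (rule moduleI)
    show "abelian_group (regular_module R)"
    proof (rule abelian_groupI)
      fix x assume "x \<in> carrier (regular_module R)"
      thus "\<exists>y\<in>carrier (regular_module R). y \<oplus>\<^bsub>regular_module R\<^esub> x = \<zero>\<^bsub>regular_module R\<^esub>"
        by (auto simp: regular_module_def intro!: bexI[of _ "\<ominus>\<^bsub>R\<^esub> x"] B.R.l_neg)
    qed (auto simp: regular_module_def B.R.a_ac)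
  qed (auto simp: regular_module_def B.R.m_assoc B.R.l_distr B.R.r_distr B.R.is_cring)
  interpret reg: module R "regular_module R" by fact
  have I_sub: "submodule I R (regular_module R)"
  proof (rule reg.module_incl_imp_submodule)
    show "I \<subseteq> carrier (regular_module R)" by (auto simp: I_def regular_module_def)
    have Iadd: "r \<oplus>\<^bsub>R\<^esub> s \<in> I" if "r \<in> I" "s \<in> I" for r s
      using h_add[OF that] that by (auto simp: I_def)
    have Imult: "r \<otimes>\<^bsub>R\<^esub> s \<in> I" if "r \<in> carrier R" "s \<in> I" for r s
      using h_smult[OF that] that by (auto simp: I_def)
    have I0: "\<zero>\<^bsub>R\<^esub> \<in> I" using G_ne b by (auto simp: I_def)
    have Ic: "r \<in> carrier R" if "r \<in> I" for r using that by (simp add: I_def)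
    have Ineg: "\<ominus>\<^bsub>R\<^esub> r \<in> I" if "r \<in> I" for r
      using Imult[OF _ that, of "\<ominus>\<^bsub>R\<^esub> \<one>\<^bsub>R\<^esub>"] Ic[OF that] by (simp add: B.R.l_minus)
    show "module R (regular_module R\<lparr>carrier := I\<rparr>)"
    proof (rule moduleI)
      show "abelian_group (regular_module R\<lparr>carrier := I\<rparr>)"
      proof (rule abelian_groupI)
        fix x assume "x \<in> carrier (regular_module R\<lparr>carrier := I\<rparr>)"
        thus "\<exists>y\<in>carrier (regular_module R\<lparr>carrier := I\<rparr>).
            y \<oplus>\<^bsub>regular_module R\<lparr>carrier := I\<rparr>\<^esub> x = \<zero>\<^bsub>regular_module R\<lparr>carrier := I\<rparr>\<^esub>"
          by (auto simp: regular_module_def Ineg Ic intro!: bexI[of _ "\<ominus>\<^bsub>R\<^esub> x"] B.R.l_neg)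
      qed (auto simp: regular_module_def B.R.a_ac Iadd I0 Ic)
    qed (auto simp: regular_module_def B.R.m_assoc B.R.l_distr B.R.r_distr B.R.is_cring Imult Ic)
  qed
  have Imod: "module R (regular_module R\<lparr>carrier := I\<rparr>)"
    by (rule submodule.submodule_is_module[OF I_sub reg])
  have h_hom: "h \<in> mod_hom R (regular_module R\<lparr>carrier := I\<rparr>) E"
    unfolding mod_hom_def
    using h_eq[OF h_add] h_eq[OF h_smult] D(2)[OF h_in] by (simp add: regular_module_def)
  have id_hom: "(\<lambda>x. x) \<in> mod_hom R (regular_module R\<lparr>carrier := I\<rparr>) (regular_module R)"
    by (auto simp: mod_hom_def regular_module_def I_def)
  obtain k where k: "k \<in> mod_hom R (regular_module R) E" and kh: "\<forall>r\<in>I. k r = h r"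
    using inj[unfolded injective_module_def, THEN conjunct2, rule_format,
      of "regular_module R\<lparr>carrier := I\<rparr>" "regular_module R" "\<lambda>x. x" h] Imod reg h_hom id_hom
    by (auto simp: inj_on_def)
  define e where "e = k \<one>\<^bsub>R\<^esub>"
  have e: "e \<in> carrier E" using k by (auto simp: e_def mod_hom_def regular_module_def)
  have k_eq: "k r = r \<odot>\<^bsub>E\<^esub> e" if "r \<in> carrier R" for r
  proof -
    have "k (r \<otimes>\<^bsub>R\<^esub> \<one>\<^bsub>R\<^esub>) = r \<odot>\<^bsub>E\<^esub> k \<one>\<^bsub>R\<^esub>"
      using k that B.R.one_closed unfolding mod_hom_def regular_module_def module.simps
        partial_object.simps mem_Collect_eq by blast
    thus ?thesis using that by (simp add: e_def)
  qed
  define G' where "G' = {(d \<oplus>\<^bsub>B\<^esub> r \<odot>\<^bsub>B\<^esub> b, y \<oplus>\<^bsub>E\<^esub> r \<odot>\<^bsub>E\<^esub> e) | d y r. (d, y) \<in> G \<and> r \<in> carrier R}"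
  have G'I: "(x, z) \<in> G'" if "(d, y) \<in> G" "r \<in> carrier R" "x = d \<oplus>\<^bsub>B\<^esub> r \<odot>\<^bsub>B\<^esub> b" "z = y \<oplus>\<^bsub>E\<^esub> r \<odot>\<^bsub>E\<^esub> e"
    for x z d y r using that unfolding G'_def by blast
  have "G' \<subseteq> carrier B \<times> carrier E" using D(1,2) b e by (auto simp: G'_def)
  moreover have "(x \<oplus>\<^bsub>B\<^esub> x', z \<oplus>\<^bsub>E\<^esub> z') \<in> G'" if "(x, z) \<in> G'" "(x', z') \<in> G'" for x z x' z'
  proof -
    from that obtain d y r d' y' r' where
      *: "(d, y) \<in> G" "r \<in> carrier R" "x = d \<oplus>\<^bsub>B\<^esub> r \<odot>\<^bsub>B\<^esub> b" "z = y \<oplus>\<^bsub>E\<^esub> r \<odot>\<^bsub>E\<^esub> e"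
         "(d', y') \<in> G" "r' \<in> carrier R" "x' = d' \<oplus>\<^bsub>B\<^esub> r' \<odot>\<^bsub>B\<^esub> b" "z' = y' \<oplus>\<^bsub>E\<^esub> r' \<odot>\<^bsub>E\<^esub> e"
      unfolding G'_def by blast
    note c = D(1,2)[OF *(1)] D(1,2)[OF *(5)]
    show ?thesis
      by (rule G'I[OF D(3)[OF *(1,5)], of "r \<oplus>\<^bsub>R\<^esub> r'"])
        (use * c b e in \<open>simp_all add: B.smult_l_distr E.smult_l_distr B.M.a_ac E.M.a_ac\<close>)
  qed
  moreover have "(s \<odot>\<^bsub>B\<^esub> x, s \<odot>\<^bsub>E\<^esub> z) \<in> G'" if s: "s \<in> carrier R" and "(x, z) \<in> G'" for s x z
  proof -
    from that obtain d y r where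
      *: "(d, y) \<in> G" "r \<in> carrier R" "x = d \<oplus>\<^bsub>B\<^esub> r \<odot>\<^bsub>B\<^esub> b" "z = y \<oplus>\<^bsub>E\<^esub> r \<odot>\<^bsub>E\<^esub> e"
      unfolding G'_def by blast
    note c = D(1,2)[OF *(1)]
    show ?thesis
      by (rule G'I[OF D(4)[OF s *(1)], of "s \<otimes>\<^bsub>R\<^esub> r"])
        (use * c b e s in \<open>simp_all add: B.smult_r_distr E.smult_r_distr B.smult_assoc1 E.smult_assoc1\<close>)
  qed
  moreover have "z = \<zero>\<^bsub>E\<^esub>" if "(\<zero>\<^bsub>B\<^esub>, z) \<in> G'" for z
  proof -
    from that obtain d y r where
      *: "(d, y) \<in> G" "r \<in> carrier R" "\<zero>\<^bsub>B\<^esub> = d \<oplus>\<^bsub>B\<^esub> r \<odot>\<^bsub>B\<^esub> b" "z = y \<oplus>\<^bsub>E\<^esub> r \<odot>\<^bsub>E\<^esub> e"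
      unfolding G'_def by blast
    note c = D(1,2)[OF *(1)]
    have "r \<odot>\<^bsub>B\<^esub> b = \<ominus>\<^bsub>B\<^esub> d"
      using *(2,3) c b by (metis B.M.a_comm B.M.minus_equality B.smult_closed)
    hence r: "(r \<odot>\<^bsub>B\<^esub> b, \<ominus>\<^bsub>E\<^esub> y) \<in> G" using partial_hom_graphs_neg[OF G B E *(1)] by simp
    hence "r \<in> I" using *(2) by (auto simp: I_def)
    hence "r \<odot>\<^bsub>E\<^esub> e = \<ominus>\<^bsub>E\<^esub> y" using kh k_eq[OF *(2)] h_eq[OF r] by simp
    thus ?thesis using *(4) c by (simp add: E.M.r_neg)
  qed
  ultimately have "G' \<in> partial_hom_graphs" unfolding partial_hom_graphs_def mem_Collect_eq by blast
  moreover have "G \<subseteq> G'"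
  proof
    fix p assume p: "p \<in> G"
    obtain d y where dy: "p = (d, y)" by (cases p)
    show "p \<in> G'" unfolding dy
      by (rule G'I[of d y "\<zero>\<^bsub>R\<^esub>"]) (use p dy D(1,2)[of d y] b e in simp_all)
  qed
  moreover have "(b, e) \<in> G'"
    by (rule G'I[OF G_ne, of "\<one>\<^bsub>R\<^esub>"]) (use b e in simp_all)
  ultimately show ?thesis by blast
qed

end

theorem injective_module_extend:
  fixes A :: "('r, 'a) module" and B :: "('r, 'b) module" and E :: "('r, 'e) module"
  assumes inj: "injective_module R E" and A: "module R A" and B: "module R B"
    and i: "i \<in> mod_hom R A B" "inj_on i (carrier A)" and f: "f \<in> mod_hom R A E"
  shows "\<exists>g\<in>mod_hom R B E. \<forall>a\<in>carrier A. g (i a) = f a"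
proof -
  have E: "module R E" using inj by (simp add: injective_module_def)
  interpret A: module R A by fact
  interpret B: module R B by fact
  interpret E: module R E by fact
  have zero_hom: "i \<zero>\<^bsub>A\<^esub> = \<zero>\<^bsub>B\<^esub>" "f \<zero>\<^bsub>A\<^esub> = \<zero>\<^bsub>E\<^esub>"
  proof -
    have "i (\<zero>\<^bsub>R\<^esub> \<odot>\<^bsub>A\<^esub> \<zero>\<^bsub>A\<^esub>) = \<zero>\<^bsub>R\<^esub> \<odot>\<^bsub>B\<^esub> i \<zero>\<^bsub>A\<^esub>" "i \<zero>\<^bsub>A\<^esub> \<in> carrier B"
      "f (\<zero>\<^bsub>R\<^esub> \<odot>\<^bsub>A\<^esub> \<zero>\<^bsub>A\<^esub>) = \<zero>\<^bsub>R\<^esub> \<odot>\<^bsub>E\<^esub> f \<zero>\<^bsub>A\<^esub>" "f \<zero>\<^bsub>A\<^esub> \<in> carrier E"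
      using i(1) f unfolding mod_hom_def by (blast intro: A.M.zero_closed A.R.zero_closed)+
    thus "i \<zero>\<^bsub>A\<^esub> = \<zero>\<^bsub>B\<^esub>" "f \<zero>\<^bsub>A\<^esub> = \<zero>\<^bsub>E\<^esub>" by simp_all
  qed
  define G0 where "G0 = (\<lambda>a. (i a, f a)) ` carrier A"
  have "G0 \<subseteq> carrier B \<times> carrier E" using i f by (auto simp: G0_def mod_hom_def)
  moreover have "(x \<oplus>\<^bsub>B\<^esub> x', y \<oplus>\<^bsub>E\<^esub> y') \<in> G0" if xy: "(x, y) \<in> G0" "(x', y') \<in> G0" for x y x' y'
  proof -
    from xy obtain a a' where "a \<in> carrier A" "a' \<in> carrier A" "x = i a" "y = f a" "x' = i a'" "y' = f a'"
      by (auto simp: G0_def)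
    thus ?thesis using i f unfolding G0_def mod_hom_def
      by (intro image_eqI[of _ _ "a \<oplus>\<^bsub>A\<^esub> a'"]) auto
  qed
  moreover have "(r \<odot>\<^bsub>B\<^esub> x, r \<odot>\<^bsub>E\<^esub> y) \<in> G0" if r: "r \<in> carrier R" and "(x, y) \<in> G0" for r x y
  proof -
    from that obtain a where "a \<in> carrier A" "x = i a" "y = f a" by (auto simp: G0_def)
    thus ?thesis using i f r unfolding G0_def mod_hom_def
      by (intro image_eqI[of _ _ "r \<odot>\<^bsub>A\<^esub> a"]) auto
  qed
  moreover have "y = \<zero>\<^bsub>E\<^esub>" if "(\<zero>\<^bsub>B\<^esub>, y) \<in> G0" for y
  proof -
    from that obtain a where a: "a \<in> carrier A" "i a = \<zero>\<^bsub>B\<^esub>" "y = f a" by (auto simp: G0_def)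
    hence "a = \<zero>\<^bsub>A\<^esub>" using i(2) zero_hom(1) by (metis A.M.zero_closed inj_onD)
    thus ?thesis using a zero_hom by simp
  qed
  ultimately have G0: "G0 \<in> partial_hom_graphs R B E"
    unfolding partial_hom_graphs_def mem_Collect_eq by blast
  have "\<exists>G\<in>{G \<in> partial_hom_graphs R B E. G0 \<subseteq> G}.
      \<forall>X\<in>{G \<in> partial_hom_graphs R B E. G0 \<subseteq> G}. G \<subseteq> X \<longrightarrow> X = G"
    by (rule subset_Zorn_nonempty) (use G0 partial_hom_graphs_chain in \<open>blast+\<close>)
  then obtain G where "G \<in> {G \<in> partial_hom_graphs R B E. G0 \<subseteq> G}"
    and m: "\<forall>X\<in>{G \<in> partial_hom_graphs R B E. G0 \<subseteq> G}. G \<subseteq> X \<longrightarrow> X = G" ..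
  hence G: "G \<in> partial_hom_graphs R B E" "G0 \<subseteq> G" by simp_all
  have max: "X = G" if "X \<in> partial_hom_graphs R B E" "G \<subseteq> X" for X
    by (rule m[THEN bspec, THEN mp, OF _ that(2)]) (simp add: that(1) order_trans[OF G(2) that(2)])
  note D = partial_hom_graphsD[OF G(1)] and U = partial_hom_graphs_unique[OF G(1) B E]
  have zG: "(\<zero>\<^bsub>B\<^esub>, \<zero>\<^bsub>E\<^esub>) \<in> G" using G(2) zero_hom A.M.zero_closed by (force simp: G0_def)
  have total: "\<exists>y. (b, y) \<in> G" if "b \<in> carrier B" for b
  proof -
    from partial_hom_graphs_step[OF inj B G(1) zG that]
    obtain G' e where "G' \<in> partial_hom_graphs R B E" "G \<subseteq> G'" "(b, e) \<in> G'"
      by (elim bexE conjE exE)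
    thus ?thesis using max[of G'] by auto
  qed
  define g where "g b = (THE y. (b, y) \<in> G)" for b
  have g_eq: "g b = y" if "(b, y) \<in> G" for b y unfolding g_def by (rule the_equality) (fact that, rule U[OF _ that])
  have g_in: "(b, g b) \<in> G" if "b \<in> carrier B" for b using total[OF that] g_eq by auto
  have "g \<in> mod_hom R B E"
    unfolding mod_hom_def
    using D(2)[OF g_in] g_eq[OF D(3)[OF g_in g_in]] g_eq[OF D(4)[OF _ g_in]] by simp
  moreover have "g (i a) = f a" if "a \<in> carrier A" for a
    using G(2) that by (intro g_eq) (auto simp: G0_def)
  ultimately show ?thesis by blast
qed

end

theory Submission
  imports Defs
begin

text \<open>The submodule \<open>\<alpha>\<^sup>\<smile>(M)\<close> is the annihilator of \<open>\<alpha>(M\<^sup>\<or>)\<close> in \<open>M\<close>. If \<open>\<alpha>\<close> is cohereditary and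
  \<open>L \<subseteq> M\<close>, then the restriction \<open>M\<^sup>\<or> \<rightarrow> L\<^sup>\<or>\<close> is surjective, since \<open>E\<close> is injective, so it maps
  \<open>\<alpha>(M\<^sup>\<or>)\<close> onto \<open>\<alpha>(L\<^sup>\<or>)\<close> and the annihilators agree on \<open>L\<close>. Conversely, a surjection
  \<open>\<pi> : M\<^sup>\<or> \<rightarrow> N\<^sup>\<or>\<close> is by Matlis duality the dual of an injection \<open>h : N \<rightarrow> M\<close>. If \<open>\<alpha>\<^sup>\<smile>\<close> is
  hereditary, then \<open>h\<close> identifies \<open>\<alpha>\<^sup>\<smile>(N)\<close> with \<open>h(N) \<inter> \<alpha>\<^sup>\<smile>(M)\<close>, which says that the
  submodules \<open>\<pi>(\<alpha>(M\<^sup>\<or>)) \<subseteq> \<alpha>(N\<^sup>\<or>)\<close> have the same annihilator in \<open>N\<close>. They are equal because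
  \<open>E\<close> is a cogenerator and every homomorphism \<open>N\<^sup>\<or> \<rightarrow> E\<close> is evaluation at an element of \<open>N\<close>.\<close>

section \<open>Homomorphisms, submodules and quotients\<close>

lemma mod_homD:
  assumes "f \<in> mod_hom R M N"
  shows "x \<in> carrier M \<Longrightarrow> f x \<in> carrier N"
    and "x \<in> carrier M \<Longrightarrow> y \<in> carrier M \<Longrightarrow> f (x \<oplus>\<^bsub>M\<^esub> y) = f x \<oplus>\<^bsub>N\<^esub> f y"
    and "r \<in> carrier R \<Longrightarrow> x \<in> carrier M \<Longrightarrow> f (r \<odot>\<^bsub>M\<^esub> x) = r \<odot>\<^bsub>N\<^esub> f x"
  using assms by (auto simp: mod_hom_def)

lemma mod_homI:
  assumes "\<And>x. x \<in> carrier M \<Longrightarrow> f x \<in> carrier N"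
    and "\<And>x y. x \<in> carrier M \<Longrightarrow> y \<in> carrier M \<Longrightarrow> f (x \<oplus>\<^bsub>M\<^esub> y) = f x \<oplus>\<^bsub>N\<^esub> f y"
    and "\<And>r x. r \<in> carrier R \<Longrightarrow> x \<in> carrier M \<Longrightarrow> f (r \<odot>\<^bsub>M\<^esub> x) = r \<odot>\<^bsub>N\<^esub> f x"
  shows "f \<in> mod_hom R M N"
  using assms by (auto simp: mod_hom_def)

lemma mod_hom_zero:
  assumes "module R M" "module R N" "f \<in> mod_hom R M N"
  shows "f \<zero>\<^bsub>M\<^esub> = \<zero>\<^bsub>N\<^esub>"
proof -
  interpret M: module R M by fact
  interpret N: module R N by fact
  have "f (\<zero>\<^bsub>R\<^esub> \<odot>\<^bsub>M\<^esub> \<zero>\<^bsub>M\<^esub>) = \<zero>\<^bsub>R\<^esub> \<odot>\<^bsub>N\<^esub> f \<zero>\<^bsub>M\<^esub>"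
    by (rule mod_homD(3)[OF assms(3)]) simp_all
  thus ?thesis using mod_homD(1)[OF assms(3)] by simp
qed

lemma mod_hom_minus:
  assumes "module R M" "module R N" "f \<in> mod_hom R M N" "x \<in> carrier M"
  shows "f (\<ominus>\<^bsub>M\<^esub> x) = \<ominus>\<^bsub>N\<^esub> f x"
proof -
  interpret M: module R M by fact
  interpret N: module R N by fact
  have "f (\<ominus>\<^bsub>M\<^esub> x) \<oplus>\<^bsub>N\<^esub> f x = \<zero>\<^bsub>N\<^esub>"
    using mod_homD(2)[OF assms(3), of "\<ominus>\<^bsub>M\<^esub> x" x] mod_hom_zero[OF assms(1-3)] assms(4)
    by (simp add: M.M.l_neg)
  thus ?thesis using mod_homD(1)[OF assms(3)] assms(4) by (simp add: N.M.minus_equality)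
qed

lemma mod_hom_compose:
  "f \<in> mod_hom R M N \<Longrightarrow> g \<in> mod_hom R N P \<Longrightarrow> (\<lambda>x. g (f x)) \<in> mod_hom R M P"
  by (auto simp: mod_hom_def Pi_iff)

lemma mod_hom_inv_into:
  assumes "module R M" "f \<in> mod_hom R M N" "bij_betw f (carrier M) (carrier N)"
  shows "inv_into (carrier M) f \<in> mod_hom R N M"
proof (rule mod_homI)
  interpret M: module R M by fact
  let ?g = "inv_into (carrier M) f"
  note g = bij_betw_inv_into_right[OF assms(3)] and g' = bij_betw_inv_into_left[OF assms(3)]
  show c: "?g y \<in> carrier M" if "y \<in> carrier N" for y
    using bij_betwE[OF bij_betw_inv_into[OF assms(3)]] that by blast
  show "?g (x \<oplus>\<^bsub>N\<^esub> y) = ?g x \<oplus>\<^bsub>M\<^esub> ?g y" if "x \<in> carrier N" "y \<in> carrier N" for x y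
    using g'[of "?g x \<oplus>\<^bsub>M\<^esub> ?g y"] mod_homD(2)[OF assms(2), of "?g x" "?g y"] that c g by simp
  show "?g (r \<odot>\<^bsub>N\<^esub> x) = r \<odot>\<^bsub>M\<^esub> ?g x" if "r \<in> carrier R" "x \<in> carrier N" for r x
    using g'[of "r \<odot>\<^bsub>M\<^esub> ?g x"] mod_homD(3)[OF assms(2), of r "?g x"] that c g by simp
qed

lemma submodule_zero:
  assumes "submodule H R M"
  shows "\<zero>\<^bsub>M\<^esub> \<in> H"
  using subgroup.one_closed[OF submodule.axioms(1)[OF assms]] by simp

lemma submodule_subset:
  assumes "submodule H R M"
  shows "H \<subseteq> carrier M"
  using subgroup.subset[OF submodule.axioms(1)[OF assms]] by simp

lemma submodule_image:
  assumes "module R M" "module R N" "f \<in> mod_hom R M N" "submodule H R M"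
  shows "submodule (f ` H) R N"
proof -
  interpret M: module R M by fact
  interpret N: module R N by fact
  note f = mod_homD[OF assms(3)] and H = M.submoduleE[OF assms(4)]
  show ?thesis
  proof (rule N.submoduleI)
    show "f ` H \<subseteq> carrier N" using f H by auto
    show "\<zero>\<^bsub>N\<^esub> \<in> f ` H"
      using mod_hom_zero[OF assms(1-3)] submodule_zero[OF assms(4)] by (metis imageI)
    show "\<ominus>\<^bsub>N\<^esub> a \<in> f ` H" if "a \<in> f ` H" for a
    proof -
      from that obtain x where "x \<in> H" "a = f x" by blast
      thus ?thesis using mod_hom_minus[OF assms(1-3), of x] H(1) H(3)[of x] by (metis imageI subsetD)
    qed
    show "a \<oplus>\<^bsub>N\<^esub> b \<in> f ` H" if "a \<in> f ` H" "b \<in> f ` H" for a b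
    proof -
      from that obtain x y where "x \<in> H" "a = f x" "y \<in> H" "b = f y" by blast
      thus ?thesis using f(2)[of x y, symmetric] H(1) H(5)[of x y] by auto
    qed
    show "r \<odot>\<^bsub>N\<^esub> a \<in> f ` H" if "r \<in> carrier R" "a \<in> f ` H" for r a
    proof -
      from that obtain x where "x \<in> H" "a = f x" by blast
      thus ?thesis using f(3)[of r x, symmetric] H(1) H(4)[of r x] that(1) by auto
    qed
  qed
qed

section \<open>The ring as a module over itself\<close>

lemma regular_module_is_module:
  assumes "cring R"
  shows "module R (regular_module R)"
proof -
  interpret R: cring R by fact
  show ?thesis
  proof (rule moduleI)
    show "abelian_group (regular_module R)"
    proof (rule abelian_groupI)
      fix x assume "x \<in> carrier (regular_module R)"
      thus "\<exists>y\<in>carrier (regular_module R). y \<oplus>\<^bsub>regular_module R\<^esub> x = \<zero>\<^bsub>regular_module R\<^esub>"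
        by (auto simp: regular_module_def intro!: bexI[of _ "\<ominus>\<^bsub>R\<^esub> x"] R.l_neg)
    qed (auto simp: regular_module_def R.a_ac)
  qed (auto simp: regular_module_def R.m_assoc R.l_distr R.r_distr R.is_cring)
qed

text \<open>The residue field is formed as a quotient of \<open>regular_module R\<close>, so the
  maximal ideal is needed as a submodule of it.\<close>

lemma ideal_imp_submodule_regular:
  assumes "cring R" "ideal I R"
  shows "submodule I R (regular_module R)"
proof -
  interpret module R "regular_module R" by (rule regular_module_is_module) fact
  interpret I: ideal I R by fact
  \<comment> \<open>\<open>regular_module R\<close> has the same additive monoid as
    \<open>R\<close>, and additive inverses depend on nothing else.\<close>
  have inv: "\<ominus>\<^bsub>regular_module R\<^esub> a = \<ominus>\<^bsub>R\<^esub> a" for a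
    by (simp add: a_inv_def regular_module_def m_inv_def)
  show ?thesis
  proof (rule submoduleI)
    show "I \<subseteq> carrier (regular_module R)" using I.a_subset by (simp add: regular_module_def)
    show "\<zero>\<^bsub>regular_module R\<^esub> \<in> I" by (simp add: regular_module_def)
    show "\<ominus>\<^bsub>regular_module R\<^esub> a \<in> I" if "a \<in> I" for a
      unfolding inv using that by simp
    show "a \<oplus>\<^bsub>regular_module R\<^esub> b \<in> I" if "a \<in> I" "b \<in> I" for a b
      using that by (simp add: regular_module_def)
    show "r \<odot>\<^bsub>regular_module R\<^esub> a \<in> I" if "r \<in> carrier R" "a \<in> I" for r a
      using that I.I_l_closed by (simp add: regular_module_def)
  qed
qed

section \<open>Quotient modules\<close>

lemma submodule_imp_abelian_subgroup:
  assumes "module R M" "submodule H R M"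
  shows "abelian_subgroup H M"
proof (rule abelian_subgroupI3)
  show "additive_subgroup H M"
    by (rule additive_subgroup.intro) (rule submodule.axioms(1)[OF assms(2)])
  show "abelian_group M" using assms(1) by (simp add: module_def)
qed

lemma quot_module_coset_eq_iff:
  assumes "module R M" "submodule H R M" "x \<in> carrier M" "y \<in> carrier M"
  shows "H +>\<^bsub>M\<^esub> x = H +>\<^bsub>M\<^esub> y \<longleftrightarrow> x \<ominus>\<^bsub>M\<^esub> y \<in> H"
proof -
  interpret module R M by fact
  interpret abelian_subgroup H M by (rule submodule_imp_abelian_subgroup[OF assms(1,2)])
  show ?thesis
    using a_rcos_module[OF assms(4,3)] a_rcos_self[OF assms(3)]
      a_repr_independence[OF _ assms(4) a_subgroup, of x] by (metis M.minus_eq)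
qed

text \<open>The zero class is written as the coset of zero rather than as \<open>H\<close>: in this
  form it is a value of the quotient map, as it arises when a homomorphism composed with that map is
  evaluated at zero.\<close>

lemma quot_module_coset_eq_zero_iff:
  assumes "module R M" "submodule H R M" "x \<in> carrier M"
  shows "H +>\<^bsub>M\<^esub> x = H +>\<^bsub>M\<^esub> \<zero>\<^bsub>M\<^esub> \<longleftrightarrow> x \<in> H"
proof -
  interpret module R M by fact
  have "\<ominus>\<^bsub>M\<^esub> \<zero>\<^bsub>M\<^esub> = \<zero>\<^bsub>M\<^esub>" by (rule M.minus_equality) simp_all
  hence "x \<ominus>\<^bsub>M\<^esub> \<zero>\<^bsub>M\<^esub> = x" using assms(3) by (simp only: M.minus_eq M.r_zero)
  thus ?thesis using quot_module_coset_eq_iff[OF assms M.zero_closed] by simp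
qed

lemma carrier_quot_module: "carrier (quot_module R M H) = (\<lambda>x. H +>\<^bsub>M\<^esub> x) ` carrier M"
  by (auto simp: quot_module_def A_RCOSETS_def')

lemma quot_module_coset_hom:
  assumes "module R M" "submodule H R M"
  shows "(\<lambda>x. H +>\<^bsub>M\<^esub> x) \<in> mod_hom R M (quot_module R M H)"
proof (rule mod_homI)
  interpret module R M by fact
  interpret abelian_subgroup H M by (rule submodule_imp_abelian_subgroup[OF assms])
  show "H +>\<^bsub>M\<^esub> x \<in> carrier (quot_module R M H)" if "x \<in> carrier M" for x
    using that by (simp add: carrier_quot_module)
  show "H +>\<^bsub>M\<^esub> (x \<oplus>\<^bsub>M\<^esub> y) = (H +>\<^bsub>M\<^esub> x) \<oplus>\<^bsub>quot_module R M H\<^esub> (H +>\<^bsub>M\<^esub> y)"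
    if "x \<in> carrier M" "y \<in> carrier M" for x y
    using a_rcos_sum[OF that] by (simp add: quot_module_def)
  show "H +>\<^bsub>M\<^esub> (r \<odot>\<^bsub>M\<^esub> x) = r \<odot>\<^bsub>quot_module R M H\<^esub> (H +>\<^bsub>M\<^esub> x)"
    if r: "r \<in> carrier R" and x: "x \<in> carrier M" for r x
  proof -
    \<comment> \<open>The scalar action on the quotient is a union over all representatives. Each of
      them yields the same coset and there is at least one, so the union is that single
      coset.\<close>
    have "H +>\<^bsub>M\<^esub> (r \<odot>\<^bsub>M\<^esub> y) = H +>\<^bsub>M\<^esub> (r \<odot>\<^bsub>M\<^esub> x)" if "y \<in> H +>\<^bsub>M\<^esub> x" for y
    proof -
      have y: "y \<in> carrier M" using that a_elemrcos_carrier[OF x that] by simp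
      have "y \<ominus>\<^bsub>M\<^esub> x \<in> H" using a_rcos_module[OF x y] that by (simp add: M.minus_eq)
      hence "r \<odot>\<^bsub>M\<^esub> (y \<ominus>\<^bsub>M\<^esub> x) \<in> H" using submodule.smult_closed[OF assms(2) r] by blast
      moreover have "r \<odot>\<^bsub>M\<^esub> (y \<ominus>\<^bsub>M\<^esub> x) = r \<odot>\<^bsub>M\<^esub> y \<ominus>\<^bsub>M\<^esub> r \<odot>\<^bsub>M\<^esub> x"
        using r x y by (simp add: M.minus_eq smult_r_distr smult_r_minus)
      ultimately show ?thesis
        using quot_module_coset_eq_iff[OF assms] r x y by simp
    qed
    moreover have "H +>\<^bsub>M\<^esub> x \<noteq> {}" using a_rcos_self[OF x] by blast
    ultimately show ?thesis by (auto simp: quot_module_def)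
  qed
qed

text \<open>Every element of the quotient is the coset of a representative, and
  \<open>quot_module_coset_hom\<close> turns operations on cosets into operations on
  representatives. Linearity of the lift is thus inherited from \<open>g\<close>.\<close>

lemma quot_module_lift:
  assumes M: "module R M" and N: "module R N" and H: "submodule H R M"
    and g: "g \<in> mod_hom R M N" and ker: "\<And>h. h \<in> H \<Longrightarrow> g h = \<zero>\<^bsub>N\<^esub>"
  shows "\<exists>k\<in>mod_hom R (quot_module R M H) N. \<forall>x\<in>carrier M. k (H +>\<^bsub>M\<^esub> x) = g x"
proof -
  interpret M: module R M by fact
  interpret N: module R N by fact
  let ?q = "\<lambda>x. H +>\<^bsub>M\<^esub> x"
  note q = mod_homD[OF quot_module_coset_hom[OF M H]] and gD = mod_homD[OF g]
  \<comment> \<open>\<open>g\<close> is constant on cosets, so the representative that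
    \<open>inv_into\<close> picks in the definition of \<open>k\<close> does not matter.\<close>
  have fac: "g x = g y" if "x \<in> carrier M" "y \<in> carrier M" "?q x = ?q y" for x y
  proof -
    have "g (x \<ominus>\<^bsub>M\<^esub> y) = \<zero>\<^bsub>N\<^esub>" using ker quot_module_coset_eq_iff[OF M H] that by blast
    hence "g x \<oplus>\<^bsub>N\<^esub> \<ominus>\<^bsub>N\<^esub> g y = \<zero>\<^bsub>N\<^esub>"
      using that gD mod_hom_minus[OF M N g] by (simp add: M.M.minus_eq)
    thus ?thesis using gD(1) that by (metis N.M.minus_equality N.M.minus_minus N.M.a_inv_closed)
  qed
  define k where "k X = g (inv_into (carrier M) ?q X)" for X
  have k: "k (?q x) = g x" if "x \<in> carrier M" for x
    unfolding k_def
    by (rule fac[OF inv_into_into that f_inv_into_f[of _ ?q]]) (use that in blast)+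
  have "k \<in> mod_hom R (quot_module R M H) N"
  proof (rule mod_homI)
    show "k X \<in> carrier N" if "X \<in> carrier (quot_module R M H)" for X
      using that k gD(1) by (auto simp: carrier_quot_module)
    show "k (X \<oplus>\<^bsub>quot_module R M H\<^esub> Y) = k X \<oplus>\<^bsub>N\<^esub> k Y"
      if "X \<in> carrier (quot_module R M H)" "Y \<in> carrier (quot_module R M H)" for X Y
      using that k gD(2) by (auto simp: carrier_quot_module q(2)[symmetric])
    show "k (r \<odot>\<^bsub>quot_module R M H\<^esub> X) = r \<odot>\<^bsub>N\<^esub> k X"
      if "r \<in> carrier R" "X \<in> carrier (quot_module R M H)" for r X
      using that k gD(3) by (auto simp: carrier_quot_module q(3)[symmetric])
  qed
  thus ?thesis using k by blast
qed

section \<open>Dual modules\<close>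

text \<open>Elements of the dual are extensional, so each module law reduces to the same law in
  \<open>E\<close> at every point of \<open>carrier M\<close>.\<close>

lemma dual_module:
  assumes "module R M" "module R E"
  shows "module R (dual R E M)"
proof -
  interpret M: module R M by fact
  interpret E: module R E by fact
  let ?D = "dual R E M"
  have hom: "f \<in> mod_hom R M E" if "f \<in> carrier ?D" for f
    using that by (simp add: dual_def)
  have I: "(\<lambda>x\<in>carrier M. f x) \<in> carrier ?D" if "f \<in> mod_hom R M E" for f
    using that by (auto simp: dual_def mod_hom_def Pi_iff)
  \<comment> \<open>Here commutativity of \<open>R\<close> enters: multiplying by \<open>r\<close>
    has to commute with the scalar \<open>s\<close>.\<close>
  have sm: "(\<lambda>x. r \<odot>\<^bsub>E\<^esub> f x) \<in> mod_hom R M E" if r: "r \<in> carrier R" and f: "f \<in> carrier ?D" for r f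
  proof (rule mod_homI)
    show "r \<odot>\<^bsub>E\<^esub> f (s \<odot>\<^bsub>M\<^esub> x) = s \<odot>\<^bsub>E\<^esub> (r \<odot>\<^bsub>E\<^esub> f x)" if "s \<in> carrier R" "x \<in> carrier M" for s x
      using mod_homD[OF hom[OF f]] r that
      by (simp add: E.smult_assoc1[symmetric] M.R.m_comm[of s r])
  qed (use mod_homD[OF hom[OF f]] r in \<open>simp_all add: E.smult_r_distr\<close>)
  have ad: "(\<lambda>x. f x \<oplus>\<^bsub>E\<^esub> g x) \<in> mod_hom R M E" if "f \<in> carrier ?D" "g \<in> carrier ?D" for f g
    using mod_homD[OF hom[OF that(1)]] mod_homD[OF hom[OF that(2)]]
    by (intro mod_homI) (simp_all add: E.smult_r_distr E.M.a_ac)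
  have add: "f \<oplus>\<^bsub>?D\<^esub> g = (\<lambda>x\<in>carrier M. f x \<oplus>\<^bsub>E\<^esub> g x)"
    and smult: "r \<odot>\<^bsub>?D\<^esub> f = (\<lambda>x\<in>carrier M. r \<odot>\<^bsub>E\<^esub> f x)"
    and zero: "\<zero>\<^bsub>?D\<^esub> = (\<lambda>x\<in>carrier M. \<zero>\<^bsub>E\<^esub>)" for f g r
    by (simp_all add: dual_def)
  have ext: "f \<in> extensional (carrier M)" if "f \<in> carrier ?D" for f
    using that by (simp add: dual_def)
  have val: "f x \<in> carrier E" if "f \<in> carrier ?D" "x \<in> carrier M" for f x
    using that by (auto simp: dual_def mod_hom_def)
  show ?thesis
  proof (rule moduleI)
    show "cring R" by (rule M.R.is_cring)
    show "abelian_group ?D"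
    proof (rule abelian_groupI)
      show "f \<oplus>\<^bsub>?D\<^esub> g \<in> carrier ?D" if "f \<in> carrier ?D" "g \<in> carrier ?D" for f g
        unfolding add by (rule I[OF ad[OF that]])
      show "\<zero>\<^bsub>?D\<^esub> \<in> carrier ?D"
        unfolding zero by (rule I) (simp add: mod_hom_def)
      show "f \<oplus>\<^bsub>?D\<^esub> g \<oplus>\<^bsub>?D\<^esub> h = f \<oplus>\<^bsub>?D\<^esub> (g \<oplus>\<^bsub>?D\<^esub> h)"
        if "f \<in> carrier ?D" "g \<in> carrier ?D" "h \<in> carrier ?D" for f g h
        unfolding add by (rule restrict_ext) (use that val in \<open>simp add: E.M.a_assoc\<close>)
      show "f \<oplus>\<^bsub>?D\<^esub> g = g \<oplus>\<^bsub>?D\<^esub> f" if "f \<in> carrier ?D" "g \<in> carrier ?D" for f g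
        unfolding add by (rule restrict_ext) (use that val in \<open>simp add: E.M.a_comm\<close>)
      show "\<zero>\<^bsub>?D\<^esub> \<oplus>\<^bsub>?D\<^esub> f = f" if "f \<in> carrier ?D" for f
        unfolding add zero
        by (rule extensionalityI[OF _ ext[OF that]]) (use that val in simp_all)
      show "\<exists>g\<in>carrier ?D. g \<oplus>\<^bsub>?D\<^esub> f = \<zero>\<^bsub>?D\<^esub>" if "f \<in> carrier ?D" for f
      proof
        \<comment> \<open>Writing the negative as multiplication by -1 makes its membership in the
          dual an instance of \<open>sm\<close>.\<close>
        show "(\<lambda>x\<in>carrier M. (\<ominus>\<^bsub>R\<^esub> \<one>\<^bsub>R\<^esub>) \<odot>\<^bsub>E\<^esub> f x) \<in> carrier ?D"
          by (rule I[OF sm[OF _ that]]) simp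
        show "(\<lambda>x\<in>carrier M. (\<ominus>\<^bsub>R\<^esub> \<one>\<^bsub>R\<^esub>) \<odot>\<^bsub>E\<^esub> f x) \<oplus>\<^bsub>?D\<^esub> f = \<zero>\<^bsub>?D\<^esub>"
          unfolding add zero
          by (rule restrict_ext) (use val[OF that] in \<open>simp add: E.smult_l_minus E.M.l_neg\<close>)
      qed
    qed
    show "r \<odot>\<^bsub>?D\<^esub> f \<in> carrier ?D" if "r \<in> carrier R" "f \<in> carrier ?D" for r f
      unfolding smult by (rule I[OF sm[OF that]])
    show "(r \<oplus>\<^bsub>R\<^esub> s) \<odot>\<^bsub>?D\<^esub> f = r \<odot>\<^bsub>?D\<^esub> f \<oplus>\<^bsub>?D\<^esub> s \<odot>\<^bsub>?D\<^esub> f"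
      if "r \<in> carrier R" "s \<in> carrier R" "f \<in> carrier ?D" for r s f
      unfolding add smult by (rule restrict_ext) (use that val in \<open>simp add: E.smult_l_distr\<close>)
    show "r \<odot>\<^bsub>?D\<^esub> (f \<oplus>\<^bsub>?D\<^esub> g) = r \<odot>\<^bsub>?D\<^esub> f \<oplus>\<^bsub>?D\<^esub> r \<odot>\<^bsub>?D\<^esub> g"
      if "r \<in> carrier R" "f \<in> carrier ?D" "g \<in> carrier ?D" for r f g
      unfolding add smult by (rule restrict_ext) (use that val in \<open>simp add: E.smult_r_distr\<close>)
    show "(r \<otimes>\<^bsub>R\<^esub> s) \<odot>\<^bsub>?D\<^esub> f = r \<odot>\<^bsub>?D\<^esub> (s \<odot>\<^bsub>?D\<^esub> f)"
      if "r \<in> carrier R" "s \<in> carrier R" "f \<in> carrier ?D" for r s f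
      unfolding smult by (rule restrict_ext) (use that val in \<open>simp add: E.smult_assoc1\<close>)
    show "\<one>\<^bsub>R\<^esub> \<odot>\<^bsub>?D\<^esub> f = f" if "f \<in> carrier ?D" for f
      unfolding smult
      by (rule extensionalityI[OF _ ext[OF that]]) (use that val in simp_all)
  qed
qed


section \<open>Evaluation and dual maps\<close>

lemma carrier_dualD:
  assumes "f \<in> carrier (dual R E M)"
  shows "f \<in> mod_hom R M E" "f \<in> extensional (carrier M)"
  using assms by (auto simp: dual_def)

lemma restrict_in_dual:
  assumes "module R M" "f \<in> mod_hom R M E"
  shows "(\<lambda>x\<in>carrier M. f x) \<in> carrier (dual R E M)"
proof -
  interpret module R M by fact
  show ?thesis using assms(2) by (auto simp: dual_def mod_hom_def Pi_iff)
qed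

lemma dual_eval_hom:
  assumes "module R E" "x \<in> carrier M"
  shows "(\<lambda>f. f x) \<in> mod_hom R (dual R E M) E"
  using assms mod_homD(1)[of _ R M E] by (intro mod_homI) (auto simp: dual_def)

lemma dual_map_in_dual:
  assumes "module R M" "h \<in> mod_hom R M N" "f \<in> carrier (dual R E N)"
  shows "dual_map M h f \<in> carrier (dual R E M)"
  unfolding dual_map_def
  by (rule restrict_in_dual[OF assms(1) mod_hom_compose[OF assms(2) carrier_dualD(1)[OF assms(3)]]])

lemma dual_map_hom:
  assumes "module R M" "h \<in> mod_hom R M N"
  shows "dual_map M h \<in> mod_hom R (dual R E N) (dual R E M)"
proof (rule mod_homI)
  show "dual_map M h f \<in> carrier (dual R E M)" if "f \<in> carrier (dual R E N)" for f
    by (rule dual_map_in_dual[OF assms that])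
qed (use mod_homD(1)[OF assms(2)] in \<open>auto simp: dual_map_def dual_def intro!: restrict_ext\<close>)

text \<open>Since \<open>E\<close> is injective, a functional on \<open>M\<close> extends along the
  embedding \<open>h\<close>. The general extension theorem is used because the carriers of
  \<open>M\<close> and \<open>N\<close> need not lie in the type of the ring.\<close>

lemma dual_map_surj:
  assumes "injective_module R E" "module R M" "module R N"
    and "h \<in> mod_hom R M N" "inj_on h (carrier M)"
  shows "dual_map M h ` carrier (dual R E N) = carrier (dual R E M)"
proof
  show "dual_map M h ` carrier (dual R E N) \<subseteq> carrier (dual R E M)"
    using dual_map_in_dual[OF assms(2,4)] by blast
  show "carrier (dual R E M) \<subseteq> dual_map M h ` carrier (dual R E N)"
  proof
    fix f assume f: "f \<in> carrier (dual R E M)"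
    obtain g where g: "g \<in> mod_hom R N E" "\<forall>x\<in>carrier M. g (h x) = f x"
      using injective_module_extend[OF assms carrier_dualD(1)[OF f]] by blast
    have "f = dual_map M h (\<lambda>x\<in>carrier N. g x)"
      unfolding dual_map_def
      by (rule extensionalityI[OF carrier_dualD(2)[OF f] restrict_extensional])
        (use g(2) mod_homD(1)[OF assms(4)] in simp)
    thus "f \<in> dual_map M h ` carrier (dual R E N)"
      using restrict_in_dual[OF assms(3) g(1)] by blast
  qed
qed

text \<open>The smile dual asks that evaluation at \<open>x\<close> factor through the quotient of
  the dual of \<open>M\<close> by its \<alpha>-part. A functional factors in this way exactly when
  it vanishes on the submodule divided out.\<close>

lemma smile_dual_eq_annihilator:
  assumes "module R M" "module R E" "submodule (\<alpha> (dual R E M)) R (dual R E M)"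
  shows "smile_dual R E \<alpha> M = {x \<in> carrier M. \<forall>f\<in>\<alpha> (dual R E M). f x = \<zero>\<^bsub>E\<^esub>}"
proof -
  let ?D = "dual R E M"
  let ?H = "\<alpha> ?D"
  let ?Q = "quot_module R ?D ?H"
  let ?q = "\<lambda>f. ?H +>\<^bsub>?D\<^esub> f"
  have D: "module R ?D" by (rule dual_module[OF assms(1,2)])
  note q = quot_module_coset_hom[OF D assms(3)]
  have HD: "?H \<subseteq> carrier ?D" by (rule submodule_subset[OF assms(3)])
  have "bidual_map R E M x \<in> dual_map ?D ?q ` carrier (dual R E ?Q)
      \<longleftrightarrow> (\<forall>f\<in>?H. f x = \<zero>\<^bsub>E\<^esub>)" if x: "x \<in> carrier M" for x
  proof
    assume "bidual_map R E M x \<in> dual_map ?D ?q ` carrier (dual R E ?Q)"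
    then obtain k where k: "k \<in> carrier (dual R E ?Q)" "bidual_map R E M x = dual_map ?D ?q k" ..
    have val: "f x = k (?q f)" if "f \<in> carrier ?D" for f
      using fun_cong[OF k(2), of f] that by (simp add: bidual_map_def dual_map_def)
    \<comment> \<open>The composite of \<open>k\<close> with the quotient map is a homomorphism
      between the modules \<open>?D\<close> and \<open>E\<close>, so \<open>mod_hom_zero\<close>
      applies to it; no module structure on \<open>?Q\<close> has been established.\<close>
    have k0: "k (?q \<zero>\<^bsub>?D\<^esub>) = \<zero>\<^bsub>E\<^esub>"
      by (rule mod_hom_zero[OF D assms(2) mod_hom_compose[OF q carrier_dualD(1)[OF k(1)]]])
    show "\<forall>f\<in>?H. f x = \<zero>\<^bsub>E\<^esub>"
    proof
      interpret D: module R ?D by fact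
      fix f assume f: "f \<in> ?H"
      hence "?q f = ?q \<zero>\<^bsub>?D\<^esub>"
        using quot_module_coset_eq_zero_iff[OF D assms(3), of f] HD by blast
      thus "f x = \<zero>\<^bsub>E\<^esub>" using val[OF subsetD[OF HD f]] k0 by simp
    qed
  next
    assume "\<forall>f\<in>?H. f x = \<zero>\<^bsub>E\<^esub>"
    then obtain k where k: "k \<in> mod_hom R ?Q E" "\<forall>f\<in>carrier ?D. k (?q f) = f x"
      using quot_module_lift[OF D assms(2,3) dual_eval_hom[OF assms(2) x]] by blast
    let ?k = "\<lambda>X\<in>carrier ?Q. k X"
    interpret D: module R ?D by fact
    \<comment> \<open>Restricting \<open>k\<close> to \<open>carrier ?Q\<close> keeps it linear
      because the carrier is closed under the operations, and this closure follows from surjectivity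
      of the quotient map.\<close>
    have "?k \<in> carrier (dual R E ?Q)"
    proof -
      have "X \<oplus>\<^bsub>?Q\<^esub> Y \<in> carrier ?Q" if "X \<in> carrier ?Q" "Y \<in> carrier ?Q" for X Y
        using that by (auto simp: carrier_quot_module mod_homD(2)[OF q, symmetric])
      moreover have "r \<odot>\<^bsub>?Q\<^esub> X \<in> carrier ?Q" if "r \<in> carrier R" "X \<in> carrier ?Q" for r X
        using that by (auto simp: carrier_quot_module mod_homD(3)[OF q, symmetric])
      ultimately show ?thesis using k(1) by (auto simp: dual_def mod_hom_def Pi_iff)
    qed
    moreover have "bidual_map R E M x = dual_map ?D ?q ?k"
      unfolding bidual_map_def dual_map_def
      by (rule restrict_ext) (use k(2) in \<open>simp add: carrier_quot_module\<close>)
    ultimately show "bidual_map R E M x \<in> dual_map ?D ?q ` carrier (dual R E ?Q)" by blast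
  qed
  thus ?thesis unfolding smile_dual_def Let_def by blast
qed

section \<open>The injective hull as a cogenerator\<close>

text \<open>In a Noetherian ring a nonempty chain of ideals contains its own union. The union of a
  chain of proper ideals is therefore proper, and Zorn's lemma applies.\<close>

lemma (in noetherian_ring) exists_maximalideal:
  assumes "ideal I R" "I \<noteq> carrier R"
  shows "\<exists>J. maximalideal J R \<and> I \<subseteq> J"
proof -
  let ?A = "{J. ideal J R \<and> I \<subseteq> J \<and> J \<noteq> carrier R}"
  have "\<exists>J\<in>?A. \<forall>X\<in>?A. J \<subseteq> X \<longrightarrow> X = J"
  proof (rule subset_Zorn_nonempty)
    show "?A \<noteq> {}" using assms by blast
    fix C assume C: "C \<noteq> {}" "subset.chain ?A C"
    hence "\<Union>C \<in> C" by (intro ideal_chain_is_trivial) (auto simp: subset_chain_def)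
    thus "\<Union>C \<in> ?A" using C(2) by (auto simp: subset_chain_def)
  qed
  then obtain J where J: "J \<in> ?A" "\<forall>X\<in>?A. J \<subseteq> X \<longrightarrow> X = J" by blast
  have "maximalideal J R"
    by (rule maximalidealI) (use J in blast)+
  thus ?thesis using J(1) by blast
qed

lemma max_ideal_local_ring:
  assumes "local_ring R"
  shows "maximalideal (max_ideal R) R"
  unfolding max_ideal_def by (rule theI') (use assms in \<open>simp add: local_ring_def\<close>)

lemma ideal_subset_max_ideal:
  assumes "noetherian_ring R" "local_ring R" "ideal I R" "I \<noteq> carrier R"
  shows "I \<subseteq> max_ideal R"
proof -
  obtain J where "maximalideal J R" "I \<subseteq> J"
    using noetherian_ring.exists_maximalideal[OF assms(1,3,4)] by blast
  thus ?thesis using assms(2) max_ideal_local_ring[OF assms(2)] by (auto simp: local_ring_def)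
qed

text \<open>A map \<open>R/\<mm> \<rightarrow> E\<close> induces a map on \<open>S + Rb\<close> that kills \<open>S\<close> but not
  \<open>b\<close>, since the ideal \<open>(S : b)\<close> is proper and so lies in \<open>\<mm>\<close>.\<close>

lemma injective_hull_separates:
  assumes noeth: "noetherian_ring R" and loc: "local_ring R"
    and hull: "injective_hull R (residue_field_module R) E"
    and B: "module R B" and S: "submodule S R B" and b: "b \<in> carrier B" "b \<notin> S"
  shows "\<exists>g\<in>mod_hom R B E. (\<forall>s\<in>S. g s = \<zero>\<^bsub>E\<^esub>) \<and> g b \<noteq> \<zero>\<^bsub>E\<^esub>"
proof -
  have inj: "injective_module R E" using hull by (simp add: injective_hull_def)
  have E: "module R E" using inj by (simp add: injective_module_def)
  interpret B: module R B by fact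
  interpret E: module R E by fact
  interpret m: maximalideal "max_ideal R" R by (rule max_ideal_local_ring[OF loc])
  note SD = B.submoduleE[OF S] and S0 = submodule_zero[OF S]
  have Sc: "s \<in> carrier B" if "s \<in> S" for s using SD(1) that by blast
  obtain j where j: "j \<in> mod_hom R (residue_field_module R) E"
    and j_inj: "inj_on j (carrier (residue_field_module R))"
    using hull by (auto simp: injective_hull_def)
  let ?R = "regular_module R"
  have Rmod: "module R ?R" by (rule regular_module_is_module[OF B.R.is_cring])
  interpret reg: module R ?R by fact
  have mR: "submodule (max_ideal R) R ?R"
    by (rule ideal_imp_submodule_regular[OF B.R.is_cring m.is_ideal])
  \<comment> \<open>\<open>p\<close> is the composite of R -> R/m with the embedding
    \<open>j\<close> of the residue field in \<open>E\<close>; injectivity of \<open>j\<close> makes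
    its kernel exactly the maximal ideal.\<close>
  define p where "p r = j (max_ideal R +>\<^bsub>?R\<^esub> r)" for r
  have p: "p \<in> mod_hom R ?R E"
    unfolding p_def
    by (rule mod_hom_compose[OF quot_module_coset_hom[OF Rmod mR] j[unfolded residue_field_module_def]])
  have p_ker: "p r = \<zero>\<^bsub>E\<^esub> \<longleftrightarrow> r \<in> max_ideal R" if "r \<in> carrier R" for r
  proof -
    have c: "r \<in> carrier ?R" using that by (simp add: regular_module_def)
    have "p r = \<zero>\<^bsub>E\<^esub> \<longleftrightarrow> p r = p \<zero>\<^bsub>?R\<^esub>" using mod_hom_zero[OF Rmod E p] by simp
    also have "\<dots> \<longleftrightarrow> max_ideal R +>\<^bsub>?R\<^esub> r = max_ideal R +>\<^bsub>?R\<^esub> \<zero>\<^bsub>?R\<^esub>"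
      unfolding p_def using c
      by (intro inj_on_eq_iff[OF j_inj]) (auto simp: residue_field_module_def carrier_quot_module)
    also have "\<dots> \<longleftrightarrow> r \<in> max_ideal R"
      by (rule quot_module_coset_eq_zero_iff[OF Rmod mR c])
    finally show ?thesis .
  qed
  have pD: "p r \<in> carrier E" "p (r \<oplus>\<^bsub>R\<^esub> s) = p r \<oplus>\<^bsub>E\<^esub> p s" "p (r \<otimes>\<^bsub>R\<^esub> s) = r \<odot>\<^bsub>E\<^esub> p s"
    if "r \<in> carrier R" "s \<in> carrier R" for r s
    using mod_homD[OF p, of r] that by (simp_all add: regular_module_def)
  \<comment> \<open>The colon ideal (S : b). It measures how far the coefficient of \<open>b\<close>
    in an element of S + Rb is from being unique.\<close>
  define I where "I = {r \<in> carrier R. r \<odot>\<^bsub>B\<^esub> b \<in> S}"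
  have "ideal I R"
  proof (rule idealI[OF B.R.ring_axioms])
    show "subgroup I (add_monoid R)"
    proof (rule B.R.add.subgroupI)
      show "\<ominus>\<^bsub>R\<^esub> r \<in> I" if "r \<in> I" for r
        using that b SD(3) by (auto simp: I_def B.smult_l_minus)
      show "r \<oplus>\<^bsub>R\<^esub> s \<in> I" if "r \<in> I" "s \<in> I" for r s
        using that b SD(5) by (auto simp: I_def B.smult_l_distr)
      show "I \<noteq> {}" using S0 b B.R.zero_closed by (auto simp: I_def intro!: exI[of _ "\<zero>\<^bsub>R\<^esub>"])
    qed (auto simp: I_def)
    show 1: "r \<otimes>\<^bsub>R\<^esub> s \<in> I" if "s \<in> I" "r \<in> carrier R" for r s
      using that b SD(4) by (auto simp: I_def B.smult_assoc1)
    show "s \<otimes>\<^bsub>R\<^esub> r \<in> I" if "s \<in> I" "r \<in> carrier R" for r s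
      using 1[OF that] B.R.m_comm[of r s] that by (simp add: I_def)
  qed
  \<comment> \<open>If 1 were in \<open>I\<close>, then \<open>b\<close> would be in
    \<open>S\<close>.\<close>
  moreover have "I \<noteq> carrier R" using b B.R.one_closed by (force simp: I_def)
  ultimately have I: "I \<subseteq> max_ideal R" by (rule ideal_subset_max_ideal[OF noeth loc])
  define A where "A = {s \<oplus>\<^bsub>B\<^esub> r \<odot>\<^bsub>B\<^esub> b | s r. s \<in> S \<and> r \<in> carrier R}"
  have AI: "x \<in> A" if "s \<in> S" "r \<in> carrier R" "x = s \<oplus>\<^bsub>B\<^esub> r \<odot>\<^bsub>B\<^esub> b" for x s r
    using that by (auto simp: A_def)
  have add: "(s \<oplus>\<^bsub>B\<^esub> r \<odot>\<^bsub>B\<^esub> b) \<oplus>\<^bsub>B\<^esub> (s' \<oplus>\<^bsub>B\<^esub> r' \<odot>\<^bsub>B\<^esub> b) = (s \<oplus>\<^bsub>B\<^esub> s') \<oplus>\<^bsub>B\<^esub> (r \<oplus>\<^bsub>R\<^esub> r') \<odot>\<^bsub>B\<^esub> b"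
    if "s \<in> S" "r \<in> carrier R" "s' \<in> S" "r' \<in> carrier R" for s r s' r'
    using that Sc b by (simp add: B.smult_l_distr B.M.a_ac)
  have smult: "t \<odot>\<^bsub>B\<^esub> (s \<oplus>\<^bsub>B\<^esub> r \<odot>\<^bsub>B\<^esub> b) = t \<odot>\<^bsub>B\<^esub> s \<oplus>\<^bsub>B\<^esub> (t \<otimes>\<^bsub>R\<^esub> r) \<odot>\<^bsub>B\<^esub> b"
    if "t \<in> carrier R" "s \<in> S" "r \<in> carrier R" for t s r
    using that Sc b by (simp add: B.smult_r_distr B.smult_assoc1)
  have A: "submodule A R B"
  proof (rule B.submoduleI)
    show "A \<subseteq> carrier B" using Sc b by (auto simp: A_def)
    show "\<zero>\<^bsub>B\<^esub> \<in> A" using b by (intro AI[OF S0 B.R.zero_closed]) simp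
    show sm: "t \<odot>\<^bsub>B\<^esub> x \<in> A" if "t \<in> carrier R" "x \<in> A" for t x
      using that AI[OF SD(4) B.R.m_closed smult] by (auto simp: A_def)
    show "x \<oplus>\<^bsub>B\<^esub> y \<in> A" if "x \<in> A" "y \<in> A" for x y
    proof -
      from that obtain s r s' r' where "s \<in> S" "r \<in> carrier R" "s' \<in> S" "r' \<in> carrier R"
        "x = s \<oplus>\<^bsub>B\<^esub> r \<odot>\<^bsub>B\<^esub> b" "y = s' \<oplus>\<^bsub>B\<^esub> r' \<odot>\<^bsub>B\<^esub> b" unfolding A_def by blast
      thus ?thesis using AI[OF SD(5) B.R.add.m_closed add] by simp
    qed
    show "\<ominus>\<^bsub>B\<^esub> x \<in> A" if "x \<in> A" for x
      using sm[of "\<ominus>\<^bsub>R\<^esub> \<one>\<^bsub>R\<^esub>", OF _ that] \<open>A \<subseteq> carrier B\<close> that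
      by (auto simp: B.smult_l_minus subset_iff)
  qed
  \<comment> \<open>Subtracting the two representations shows that (r - r')b lies in
    \<open>S\<close>. So r - r' is in \<open>I\<close>, hence in the maximal ideal, and
    \<open>p\<close> kills it.\<close>
  have wd: "p r = p r'" if "s \<in> S" "r \<in> carrier R" "s' \<in> S" "r' \<in> carrier R"
    "s \<oplus>\<^bsub>B\<^esub> r \<odot>\<^bsub>B\<^esub> b = s' \<oplus>\<^bsub>B\<^esub> r' \<odot>\<^bsub>B\<^esub> b" for s r s' r'
  proof -
    have "(s \<oplus>\<^bsub>B\<^esub> r \<odot>\<^bsub>B\<^esub> b) \<oplus>\<^bsub>B\<^esub> \<ominus>\<^bsub>B\<^esub> (s' \<oplus>\<^bsub>B\<^esub> r' \<odot>\<^bsub>B\<^esub> b) = \<zero>\<^bsub>B\<^esub>"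
      unfolding that(5) using that(3,4) Sc b by (simp add: B.M.r_neg)
    hence "(s \<oplus>\<^bsub>B\<^esub> \<ominus>\<^bsub>B\<^esub> s') \<oplus>\<^bsub>B\<^esub> (r \<oplus>\<^bsub>R\<^esub> \<ominus>\<^bsub>R\<^esub> r') \<odot>\<^bsub>B\<^esub> b = \<zero>\<^bsub>B\<^esub>"
      using that(1-4) Sc b
      by (simp add: B.smult_l_distr B.smult_l_minus B.M.minus_add B.M.a_ac)
    hence "\<ominus>\<^bsub>B\<^esub> (s \<oplus>\<^bsub>B\<^esub> \<ominus>\<^bsub>B\<^esub> s') = (r \<oplus>\<^bsub>R\<^esub> \<ominus>\<^bsub>R\<^esub> r') \<odot>\<^bsub>B\<^esub> b"
      using that(1-4) Sc b by (intro B.M.minus_equality) (simp_all add: B.M.a_comm)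
    hence "r \<oplus>\<^bsub>R\<^esub> \<ominus>\<^bsub>R\<^esub> r' \<in> I"
      using that(1-4) SD(3)[OF SD(5)[OF that(1) SD(3)[OF that(3)]]] by (simp add: I_def)
    hence "p (r \<oplus>\<^bsub>R\<^esub> \<ominus>\<^bsub>R\<^esub> r') = \<zero>\<^bsub>E\<^esub>" using I p_ker that by auto
    moreover have "p (\<ominus>\<^bsub>R\<^esub> r') \<oplus>\<^bsub>E\<^esub> p r' = \<zero>\<^bsub>E\<^esub>"
      using pD(2)[of "\<ominus>\<^bsub>R\<^esub> r'" r'] p_ker[OF B.R.zero_closed] that(4) by (simp add: B.R.l_neg)
    ultimately show ?thesis using that(2,4) pD(1,2)
      by (metis B.R.a_inv_closed E.M.minus_equality E.M.minus_minus E.M.a_inv_closed E.M.a_comm)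
  qed
  \<comment> \<open>The intended map sends s + rb to p r. A coefficient is chosen, and
    \<open>wd\<close> makes the value independent of the choice.\<close>
  define f where "f x = p (SOME r. r \<in> carrier R \<and> (\<exists>s\<in>S. x = s \<oplus>\<^bsub>B\<^esub> r \<odot>\<^bsub>B\<^esub> b))" for x
  have f: "f (s \<oplus>\<^bsub>B\<^esub> r \<odot>\<^bsub>B\<^esub> b) = p r" if "s \<in> S" "r \<in> carrier R" for s r
  proof -
    let ?P = "\<lambda>r'. r' \<in> carrier R \<and> (\<exists>s'\<in>S. s \<oplus>\<^bsub>B\<^esub> r \<odot>\<^bsub>B\<^esub> b = s' \<oplus>\<^bsub>B\<^esub> r' \<odot>\<^bsub>B\<^esub> b)"
    have "?P r" using that by blast
    hence "?P (SOME r'. ?P r')" by (rule someI)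
    then obtain s' where *: "s' \<in> S" "(SOME r'. ?P r') \<in> carrier R"
      "s \<oplus>\<^bsub>B\<^esub> r \<odot>\<^bsub>B\<^esub> b = s' \<oplus>\<^bsub>B\<^esub> (SOME r'. ?P r') \<odot>\<^bsub>B\<^esub> b" by blast
    show ?thesis unfolding f_def by (rule wd[OF that *, symmetric])
  qed
  have fhom: "f \<in> mod_hom R (B\<lparr>carrier := A\<rparr>) E"
  proof (rule mod_homI)
    show "f x \<in> carrier E" if "x \<in> carrier (B\<lparr>carrier := A\<rparr>)" for x
      using that f pD(1) by (auto simp: A_def)
    show "f (x \<oplus>\<^bsub>B\<lparr>carrier := A\<rparr>\<^esub> y) = f x \<oplus>\<^bsub>E\<^esub> f y"
      if xy: "x \<in> carrier (B\<lparr>carrier := A\<rparr>)" "y \<in> carrier (B\<lparr>carrier := A\<rparr>)" for x y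
    proof -
      from xy obtain s r s' r' where "s \<in> S" "r \<in> carrier R" "s' \<in> S" "r' \<in> carrier R"
        "x = s \<oplus>\<^bsub>B\<^esub> r \<odot>\<^bsub>B\<^esub> b" "y = s' \<oplus>\<^bsub>B\<^esub> r' \<odot>\<^bsub>B\<^esub> b" by (auto simp: A_def)
      thus ?thesis using add f pD(2) SD(5) by simp
    qed
    show "f (t \<odot>\<^bsub>B\<lparr>carrier := A\<rparr>\<^esub> x) = t \<odot>\<^bsub>E\<^esub> f x"
      if "t \<in> carrier R" "x \<in> carrier (B\<lparr>carrier := A\<rparr>)" for t x
      using that smult f pD(3) SD(4) by (auto simp: A_def)
  qed
  have incl: "(\<lambda>x. x) \<in> mod_hom R (B\<lparr>carrier := A\<rparr>) B"
    using submodule_subset[OF A] by (intro mod_homI) auto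
  obtain g where g: "g \<in> mod_hom R B E" "\<forall>x\<in>A. g x = f x"
    using injective_module_extend[OF inj submodule.submodule_is_module[OF A B] B incl _ fhom]
    by (auto simp: inj_on_def)
  have "g s = \<zero>\<^bsub>E\<^esub>" if "s \<in> S" for s
  proof -
    have eq: "s = s \<oplus>\<^bsub>B\<^esub> \<zero>\<^bsub>R\<^esub> \<odot>\<^bsub>B\<^esub> b" using Sc that b by simp
    have "g s = f s" using g(2) AI[OF that B.R.zero_closed eq] by blast
    also have "f s = p \<zero>\<^bsub>R\<^esub>" using f[OF that B.R.zero_closed] eq by simp
    finally show ?thesis using p_ker[OF B.R.zero_closed] by simp
  qed
  \<comment> \<open>The value at \<open>b\<close> is p 1, which is nonzero because 1 is not in the
    maximal ideal.\<close>
  moreover have "g b \<noteq> \<zero>\<^bsub>E\<^esub>"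
  proof -
    have eq: "b = \<zero>\<^bsub>B\<^esub> \<oplus>\<^bsub>B\<^esub> \<one>\<^bsub>R\<^esub> \<odot>\<^bsub>B\<^esub> b" using b by simp
    have "g b = f b" using g(2) AI[OF S0 B.R.one_closed eq] by blast
    also have "f b = p \<one>\<^bsub>R\<^esub>" using f[OF S0 B.R.one_closed] eq by simp
    finally show ?thesis using p_ker[OF B.R.one_closed] m.one_imp_carrier m.I_notcarr by auto
  qed
  ultimately show ?thesis using g(1) by blast
qed

section \<open>Matlis duality\<close>

lemma matlis_dualizable_module: "matlis_dualizable R E M \<Longrightarrow> module R M"
  by (simp add: matlis_dualizable_def)

text \<open>This is the injective half of biduality: functionals separate the points of
  \<open>M\<close>.\<close>

lemma matlis_dualizable_eqI:
  assumes "matlis_dualizable R E M" "x \<in> carrier M" "y \<in> carrier M"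
    and "\<And>f. f \<in> carrier (dual R E M) \<Longrightarrow> f x = f y"
  shows "x = y"
proof -
  have "bidual_map R E M x = bidual_map R E M y"
    unfolding bidual_map_def by (rule restrict_ext) (rule assms(4))
  thus ?thesis using assms(1-3) by (auto simp: matlis_dualizable_def bij_betw_def inj_on_def)
qed

text \<open>This is the surjective half of biduality. \<open>g\<close> is first restricted to the
  carrier, since elements of the bidual are extensional.\<close>

lemma matlis_dualizable_eval:
  assumes "matlis_dualizable R E M" "module R E" "g \<in> mod_hom R (dual R E M) E"
  shows "\<exists>x\<in>carrier M. \<forall>f\<in>carrier (dual R E M). g f = f x"
proof -
  let ?D = "dual R E M"
  have M: "module R M" by (rule matlis_dualizable_module[OF assms(1)])
  have "(\<lambda>f\<in>carrier ?D. g f) \<in> carrier (dual R E ?D)"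
    by (rule restrict_in_dual[OF dual_module[OF M assms(2)] assms(3)])
  then obtain x where x: "x \<in> carrier M" "(\<lambda>f\<in>carrier ?D. g f) = bidual_map R E M x"
    using assms(1) by (auto simp: matlis_dualizable_def bij_betw_def)
  have "g f = f x" if "f \<in> carrier ?D" for f
    using fun_cong[OF x(2), of f] that by (simp add: bidual_map_def)
  thus ?thesis using x(1) by blast
qed

text \<open>Fullness of the duality: for fixed \<open>x\<close> in \<open>N\<close> the map sending
  \<open>f\<close> to \<open>\<pi> f x\<close> is a functional on the dual of \<open>M\<close>,
  hence evaluation at a point of \<open>M\<close>, which is taken as \<open>h x\<close>.\<close>

lemma matlis_dualizable_hom_dual:
  assumes M: "matlis_dualizable R E M" and N: "module R N" and E: "module R E"
    and \<pi>: "\<pi> \<in> mod_hom R (dual R E M) (dual R E N)"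
  shows "\<exists>h\<in>mod_hom R N M. \<forall>f\<in>carrier (dual R E M). \<pi> f = dual_map N h f"
proof -
  interpret M: module R M by (rule matlis_dualizable_module[OF M])
  interpret N: module R N by fact
  have "\<exists>y\<in>carrier M. \<forall>f\<in>carrier (dual R E M). \<pi> f x = f y" if "x \<in> carrier N" for x
    by (rule matlis_dualizable_eval[OF M E mod_hom_compose[OF \<pi> dual_eval_hom[OF E that]]])
  then obtain h where h: "\<And>x. x \<in> carrier N \<Longrightarrow> h x \<in> carrier M"
    "\<And>x f. x \<in> carrier N \<Longrightarrow> f \<in> carrier (dual R E M) \<Longrightarrow> \<pi> f x = f (h x)" by metis
  have \<pi>D: "\<pi> f \<in> mod_hom R N E" "\<pi> f \<in> extensional (carrier N)" if "f \<in> carrier (dual R E M)" for f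
    using carrier_dualD[OF mod_homD(1)[OF \<pi> that]] by auto
  have "h \<in> mod_hom R N M"
  proof (rule mod_homI)
    \<comment> \<open>Functionals separate the points of \<open>M\<close>, so linearity of
      \<open>h\<close> may be tested after applying each \<open>f\<close>, where it becomes
      linearity of \<open>\<pi> f\<close> and of \<open>f\<close>.\<close>
    show "h (x \<oplus>\<^bsub>N\<^esub> y) = h x \<oplus>\<^bsub>M\<^esub> h y" if xy: "x \<in> carrier N" "y \<in> carrier N" for x y
    proof (rule matlis_dualizable_eqI[OF M])
      fix f assume f: "f \<in> carrier (dual R E M)"
      show "f (h (x \<oplus>\<^bsub>N\<^esub> y)) = f (h x \<oplus>\<^bsub>M\<^esub> h y)"
        using mod_homD(2)[OF \<pi>D(1)[OF f] xy] mod_homD(2)[OF carrier_dualD(1)[OF f]] h f xy by simp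
    qed (use h(1) xy in auto)
    show "h (r \<odot>\<^bsub>N\<^esub> x) = r \<odot>\<^bsub>M\<^esub> h x" if rx: "r \<in> carrier R" "x \<in> carrier N" for r x
    proof (rule matlis_dualizable_eqI[OF M])
      fix f assume f: "f \<in> carrier (dual R E M)"
      show "f (h (r \<odot>\<^bsub>N\<^esub> x)) = f (r \<odot>\<^bsub>M\<^esub> h x)"
        using mod_homD(3)[OF \<pi>D(1)[OF f] rx] mod_homD(3)[OF carrier_dualD(1)[OF f]] h f rx by simp
    qed (use h(1) rx in auto)
  qed (rule h(1))
  moreover have "\<pi> f = dual_map N h f" if "f \<in> carrier (dual R E M)" for f
    unfolding dual_map_def
    by (rule extensionalityI[OF \<pi>D(2)[OF that] restrict_extensional]) (use h(2) that in simp)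
  ultimately show ?thesis by blast
qed

section \<open>Preradicals and the smile dual\<close>

text \<open>Functoriality for \<open>f\<close> gives one inclusion and functoriality for its inverse
  gives the other.\<close>

lemma preradical_image_iso:
  assumes "preradical R C \<alpha>" "M \<in> C" "N \<in> C" "module R M"
    and "f \<in> mod_hom R M N" "bij_betw f (carrier M) (carrier N)"
  shows "f ` \<alpha> M = \<alpha> N"
proof
  show "f ` \<alpha> M \<subseteq> \<alpha> N" using assms by (auto simp: preradical_def)
  let ?g = "inv_into (carrier M) f"
  have "?g ` \<alpha> N \<subseteq> \<alpha> M"
    using assms(1-3) mod_hom_inv_into[OF assms(4-6)] by (auto simp: preradical_def)
  moreover have "\<alpha> N \<subseteq> carrier N"
    using assms(1,3) submodule_subset by (auto simp: preradical_def)
  ultimately show "\<alpha> N \<subseteq> f ` \<alpha> M"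
    using bij_betw_inv_into_right[OF assms(6)] by (force intro: rev_image_eqI)
qed

lemma dual_in_dual_class:
  assumes "M \<in> C" "module R M" "module R E"
  shows "dual R E M \<in> dual_class R E C"
proof -
  have "mod_iso R (dual R E M) (dual R E M)"
    unfolding mod_iso_def by (rule bexI[of _ id]) (auto simp: mod_hom_def)
  thus ?thesis using assms dual_module[OF assms(2,3)] by (auto simp: dual_class_def)
qed

text \<open>Being a preradical is part of \<open>hereditary\<close>, so it has to be supplied. In
  terms of annihilators functoriality is short: precomposition with \<open>g\<close> sends the
  \<alpha>-part of the dual of \<open>N\<close> into that of the dual of \<open>M\<close>, so a
  point killed by the latter has its image under \<open>g\<close> killed by the former.\<close>

lemma preradical_smile_dual:
  assumes E: "module R E" and C: "\<And>M. M \<in> C \<Longrightarrow> module R M"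
    and \<alpha>: "preradical R (dual_class R E C) \<alpha>"
  shows "preradical R C (smile_dual R E \<alpha>)"
proof -
  interpret E: module R E by fact
  have dc: "dual R E M \<in> dual_class R E C" if "M \<in> C" for M
    by (rule dual_in_dual_class[OF that C[OF that] E])
  have sub: "submodule (\<alpha> (dual R E M)) R (dual R E M)" if "M \<in> C" for M
    using \<alpha> dc[OF that] by (simp add: preradical_def)
  have sm: "smile_dual R E \<alpha> M = {x \<in> carrier M. \<forall>f\<in>\<alpha> (dual R E M). f x = \<zero>\<^bsub>E\<^esub>}" if "M \<in> C" for M
    by (rule smile_dual_eq_annihilator[where \<alpha> = \<alpha>, OF C[OF that] E sub[OF that]])
  have hom: "f \<in> mod_hom R M E" if "f \<in> \<alpha> (dual R E M)" "M \<in> C" for f M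
    using submodule_subset[OF sub[OF that(2)]] that(1) carrier_dualD(1) by blast
  have "submodule (smile_dual R E \<alpha> M) R M" if M: "M \<in> C" for M
  proof -
    interpret M: module R M by (rule C[OF M])
    note h = hom[OF _ M]
    let ?A = "{x \<in> carrier M. \<forall>f\<in>\<alpha> (dual R E M). f x = \<zero>\<^bsub>E\<^esub>}"
    have "submodule ?A R M"
    proof (rule M.submoduleI)
      show "?A \<subseteq> carrier M" by blast
      show "\<zero>\<^bsub>M\<^esub> \<in> ?A" using mod_hom_zero[OF C[OF M] E h] by blast
      show "\<ominus>\<^bsub>M\<^esub> x \<in> ?A" if x: "x \<in> ?A" for x
      proof -
        have "f (\<ominus>\<^bsub>M\<^esub> x) = \<zero>\<^bsub>E\<^esub>" if f: "f \<in> \<alpha> (dual R E M)" for f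
        proof -
          have "x \<in> carrier M" "f x = \<zero>\<^bsub>E\<^esub>" using x f by blast+
          thus ?thesis using mod_hom_minus[OF C[OF M] E h[OF f], of x] E.M.minus_equality[of "\<zero>\<^bsub>E\<^esub>" "\<zero>\<^bsub>E\<^esub>"] by simp
        qed
        thus ?thesis using x by blast
      qed
      show "x \<oplus>\<^bsub>M\<^esub> y \<in> ?A" if x: "x \<in> ?A" and y: "y \<in> ?A" for x y
      proof -
        have "f (x \<oplus>\<^bsub>M\<^esub> y) = \<zero>\<^bsub>E\<^esub>" if f: "f \<in> \<alpha> (dual R E M)" for f
        proof -
          have "x \<in> carrier M" "f x = \<zero>\<^bsub>E\<^esub>" "y \<in> carrier M" "f y = \<zero>\<^bsub>E\<^esub>" using x y f by blast+
          thus ?thesis using mod_homD(2)[OF h[OF f], of x y] by simp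
        qed
        thus ?thesis using x y by blast
      qed
      show "r \<odot>\<^bsub>M\<^esub> x \<in> ?A" if r: "r \<in> carrier R" and x: "x \<in> ?A" for r x
      proof -
        have "f (r \<odot>\<^bsub>M\<^esub> x) = \<zero>\<^bsub>E\<^esub>" if f: "f \<in> \<alpha> (dual R E M)" for f
        proof -
          have "x \<in> carrier M" "f x = \<zero>\<^bsub>E\<^esub>" using x f by blast+
          thus ?thesis using mod_homD(3)[OF h[OF f] r, of x] r by simp
        qed
        thus ?thesis using r x by blast
      qed
    qed
    thus ?thesis by (simp only: sm[OF M])
  qed
  moreover have "g x \<in> smile_dual R E \<alpha> N"
    if M: "M \<in> C" and N: "N \<in> C" and g: "g \<in> mod_hom R M N" and x: "x \<in> smile_dual R E \<alpha> M" for M N g x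
  proof -
    have x': "x \<in> carrier M" "\<And>f. f \<in> \<alpha> (dual R E M) \<Longrightarrow> f x = \<zero>\<^bsub>E\<^esub>" using x sm[OF M] by auto
    have "f (g x) = \<zero>\<^bsub>E\<^esub>" if "f \<in> \<alpha> (dual R E N)" for f
    proof -
      have "dual_map M g f \<in> \<alpha> (dual R E M)"
        using \<alpha> dc[OF M] dc[OF N] dual_map_hom[OF C[OF M] g] that unfolding preradical_def by blast
      from x'(2)[OF this] show ?thesis using x'(1) by (simp add: dual_map_def)
    qed
    thus ?thesis using sm[OF N] mod_homD(1)[OF g] x'(1) by auto
  qed
  ultimately show ?thesis by (auto simp: preradical_def)
qed




text \<open>A double annihilator principle. An element of \<open>T\<close> outside \<open>S\<close>
  is separated from \<open>S\<close> by a functional on the dual of \<open>M\<close>; by biduality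
  this is evaluation at a point of \<open>M\<close>, which annihilates \<open>S\<close> but not that
  element.\<close>

lemma dual_submodule_subset_by_annihilator:
  assumes "noetherian_ring R" "local_ring R" "injective_hull R (residue_field_module R) E"
    and "module R E" and M: "matlis_dualizable R E M"
    and S: "submodule S R (dual R E M)" and T: "T \<subseteq> carrier (dual R E M)"
    and ann: "\<And>x t. x \<in> carrier M \<Longrightarrow> (\<And>s. s \<in> S \<Longrightarrow> s x = \<zero>\<^bsub>E\<^esub>) \<Longrightarrow> t \<in> T \<Longrightarrow> t x = \<zero>\<^bsub>E\<^esub>"
  shows "T \<subseteq> S"
proof (rule ccontr)
  assume "\<not> T \<subseteq> S"
  then obtain t where t: "t \<in> T" "t \<notin> S" by blast
  hence tD: "t \<in> carrier (dual R E M)" using T by blast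
  obtain g where g: "g \<in> mod_hom R (dual R E M) E" "\<forall>s\<in>S. g s = \<zero>\<^bsub>E\<^esub>" "g t \<noteq> \<zero>\<^bsub>E\<^esub>"
    using injective_hull_separates[OF assms(1-3) dual_module[OF matlis_dualizable_module[OF M] assms(4)]
      S tD t(2)] by blast
  obtain x where x: "x \<in> carrier M" "\<forall>f\<in>carrier (dual R E M). g f = f x"
    using matlis_dualizable_eval[OF M assms(4) g(1)] by blast
  have "t x = \<zero>\<^bsub>E\<^esub>"
    by (rule ann[OF x(1) _ t(1)]) (use g(2) x(2) submodule_subset[OF S] in \<open>metis subsetD\<close>)
  thus False using g(3) x(2) tD by simp
qed

section \<open>The two implications\<close>

lemma cohereditary_imp_hereditary_smile_dual:
  assumes inj: "injective_module R E" and C: "\<And>M. M \<in> C \<Longrightarrow> module R M"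
    and co: "cohereditary R (dual_class R E C) \<alpha>"
  shows "hereditary R C (smile_dual R E \<alpha>)"
proof -
  have E: "module R E" using inj by (simp add: injective_module_def)
  have \<alpha>: "preradical R (dual_class R E C) \<alpha>" using co by (simp add: cohereditary_def)
  have smile: "preradical R C (smile_dual R E \<alpha>)" by (rule preradical_smile_dual[OF E C \<alpha>])
  have dc: "dual R E M \<in> dual_class R E C" if "M \<in> C" for M
    by (rule dual_in_dual_class[OF that C[OF that] E])
  have sm: "smile_dual R E \<alpha> M = {x \<in> carrier M. \<forall>f\<in>\<alpha> (dual R E M). f x = \<zero>\<^bsub>E\<^esub>}" if "M \<in> C" for M
    using \<alpha> dc[OF that] C[OF that] E by (intro smile_dual_eq_annihilator) (auto simp: preradical_def)
  have "smile_dual R E \<alpha> (M\<lparr>carrier := L\<rparr>) = L \<inter> smile_dual R E \<alpha> M"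
    if M: "M \<in> C" and L: "submodule L R M" and LC: "M\<lparr>carrier := L\<rparr> \<in> C" for M L
  proof
    let ?L = "M\<lparr>carrier := L\<rparr>"
    have incl: "(\<lambda>x. x) \<in> mod_hom R ?L M" using submodule_subset[OF L] by (intro mod_homI) auto
    have "smile_dual R E \<alpha> ?L \<subseteq> smile_dual R E \<alpha> M"
      using smile M LC incl by (fastforce simp: preradical_def)
    moreover have "smile_dual R E \<alpha> ?L \<subseteq> L" using sm[OF LC] by auto
    ultimately show "smile_dual R E \<alpha> ?L \<subseteq> L \<inter> smile_dual R E \<alpha> M" by simp
    \<comment> \<open>The dual of the inclusion is restriction of functionals to \<open>L\<close>.
      It is surjective, so by cohereditarity each functional in the \<alpha>-part for
      \<open>L\<close> is the restriction of one in the \<alpha>-part for \<open>M\<close>.\<close>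
    have "dual_map ?L (\<lambda>x. x) ` carrier (dual R E M) = carrier (dual R E ?L)"
      by (rule dual_map_surj[OF inj C[OF LC] C[OF M] incl]) (simp add: inj_on_def)
    hence img: "dual_map ?L (\<lambda>x. x) ` \<alpha> (dual R E M) = \<alpha> (dual R E ?L)"
      using co dc[OF M] dc[OF LC] dual_map_hom[OF C[OF LC] incl] unfolding cohereditary_def by blast
    have "f x = \<zero>\<^bsub>E\<^esub>" if x: "x \<in> L" "x \<in> smile_dual R E \<alpha> M" and f: "f \<in> \<alpha> (dual R E ?L)" for x f
    proof -
      obtain g where g: "g \<in> \<alpha> (dual R E M)" "f = dual_map ?L (\<lambda>x. x) g" using f img by blast
      have "f x = g x" using g(2) x(1) by (simp add: dual_map_def)
      also have "g x = \<zero>\<^bsub>E\<^esub>" using g(1) x(2) sm[OF M] by blast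
      finally show ?thesis .
    qed
    hence "x \<in> smile_dual R E \<alpha> ?L" if "x \<in> L" "x \<in> smile_dual R E \<alpha> M" for x
      unfolding sm[OF LC] using that by simp
    thus "L \<inter> smile_dual R E \<alpha> M \<subseteq> smile_dual R E \<alpha> ?L" by blast
  qed
  thus ?thesis using smile by (auto simp: hereditary_def)
qed

text \<open>This treats surjections between actual duals, where \<pi> comes from a map
  \<open>h\<close> of the underlying modules; \<open>cohereditary_dual_classI\<close> passes to
  isomorphic copies.\<close>

lemma hereditary_smile_dual_image:
  assumes R: "noetherian_ring R" "local_ring R" and hull: "injective_hull R (residue_field_module R) E"
    and dualizable: "\<And>M. M \<in> C \<Longrightarrow> matlis_dualizable R E M" and subC: "submodule_closed R C"
    and \<alpha>: "preradical R (dual_class R E C) \<alpha>" and her: "hereditary R C (smile_dual R E \<alpha>)"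
    and M: "M \<in> C" and N: "N \<in> C"
    and \<pi>: "\<pi> \<in> mod_hom R (dual R E M) (dual R E N)"
    and surj: "\<pi> ` carrier (dual R E M) = carrier (dual R E N)"
  shows "\<pi> ` \<alpha> (dual R E M) = \<alpha> (dual R E N)"
proof
  have E: "module R E" using hull by (simp add: injective_hull_def injective_module_def)
  have C: "module R M" if "M \<in> C" for M by (rule matlis_dualizable_module[OF dualizable[OF that]])
  have dc: "dual R E M \<in> dual_class R E C" if "M \<in> C" for M
    by (rule dual_in_dual_class[OF that C[OF that] E])
  have sub: "submodule (\<alpha> (dual R E M)) R (dual R E M)" if "M \<in> C" for M
    using \<alpha> dc[OF that] by (simp add: preradical_def)
  have sm: "smile_dual R E \<alpha> M = {x \<in> carrier M. \<forall>f\<in>\<alpha> (dual R E M). f x = \<zero>\<^bsub>E\<^esub>}" if "M \<in> C" for M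
    using sub[OF that] C[OF that] E by (intro smile_dual_eq_annihilator)
  show "\<pi> ` \<alpha> (dual R E M) \<subseteq> \<alpha> (dual R E N)"
    using \<alpha> dc[OF M] dc[OF N] \<pi> unfolding preradical_def by blast
  obtain h where h: "h \<in> mod_hom R N M" and \<pi>_eq: "\<forall>f\<in>carrier (dual R E M). \<pi> f = dual_map N h f"
    using matlis_dualizable_hom_dual[OF dualizable[OF M] C[OF N] E \<pi>] by blast
  have \<pi>h: "\<pi> f x = f (h x)" if "f \<in> carrier (dual R E M)" "x \<in> carrier N" for f x
    using \<pi>_eq that by (simp add: dual_map_def)
  \<comment> \<open>As \<pi> is surjective, every functional on \<open>N\<close> is some
    \<open>f\<close> composed with \<open>h\<close>. Points with equal image under \<open>h\<close>
    are thus not separated by any functional.\<close>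
  have h_inj: "inj_on h (carrier N)"
  proof (rule inj_onI)
    fix x y assume xy: "x \<in> carrier N" "y \<in> carrier N" "h x = h y"
    show "x = y"
    proof (rule matlis_dualizable_eqI[OF dualizable[OF N] xy(1,2)])
      fix g assume "g \<in> carrier (dual R E N)"
      then obtain f where "f \<in> carrier (dual R E M)" "g = \<pi> f" using surj by blast
      thus "g x = g y" using \<pi>h xy by simp
    qed
  qed
  \<comment> \<open>The image of \<open>h\<close> is a submodule of \<open>M\<close> isomorphic to
    \<open>N\<close>; it stands in for \<open>N\<close>, since \<open>hereditary\<close> speaks of
    actual submodules only.\<close>
  let ?L = "M\<lparr>carrier := h ` carrier N\<rparr>"
  have L: "submodule (h ` carrier N) R M"
    by (rule submodule_image[OF C[OF N] C[OF M] h module.carrier_is_submodule[OF C[OF N]]])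
  have LC: "?L \<in> C" using subC M L by (simp add: submodule_closed_def)
  have "h \<in> mod_hom R N ?L" using mod_homD[OF h] by (intro mod_homI) auto
  hence "h ` smile_dual R E \<alpha> N = smile_dual R E \<alpha> ?L"
    using her N LC C[OF N] h_inj
    by (intro preradical_image_iso) (auto simp: hereditary_def bij_betw_def)
  also have "\<dots> = h ` carrier N \<inter> smile_dual R E \<alpha> M" using her M L LC by (simp add: hereditary_def)
  finally have smile: "h ` smile_dual R E \<alpha> N = h ` carrier N \<inter> smile_dual R E \<alpha> M" .
  show "\<alpha> (dual R E N) \<subseteq> \<pi> ` \<alpha> (dual R E M)"
  proof (rule dual_submodule_subset_by_annihilator[OF R hull E dualizable[OF N]])
    show "submodule (\<pi> ` \<alpha> (dual R E M)) R (dual R E N)"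
      by (rule submodule_image[OF dual_module[OF C[OF M] E] dual_module[OF C[OF N] E] \<pi> sub[OF M]])
    show "\<alpha> (dual R E N) \<subseteq> carrier (dual R E N)" by (rule submodule_subset[OF sub[OF N]])
    fix x t assume x: "x \<in> carrier N" and t: "t \<in> \<alpha> (dual R E N)"
      and ann: "\<And>s. s \<in> \<pi> ` \<alpha> (dual R E M) \<Longrightarrow> s x = \<zero>\<^bsub>E\<^esub>"
    \<comment> \<open>If the image of the \<alpha>-part for \<open>M\<close> kills \<open>x\<close>,
      then the \<alpha>-part itself kills \<open>h x\<close>. So \<open>h x\<close> is in the smile
      dual of \<open>M\<close> and in the image of \<open>h\<close>, and \<open>smile\<close> with
      injectivity of \<open>h\<close> returns \<open>x\<close> to the smile dual of
      \<open>N\<close>.\<close>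
    have "f (h x) = \<zero>\<^bsub>E\<^esub>" if "f \<in> \<alpha> (dual R E M)" for f
      using ann[of "\<pi> f"] \<pi>h[of f x] x that submodule_subset[OF sub[OF M]] by auto
    hence "h x \<in> h ` smile_dual R E \<alpha> N"
      unfolding smile using sm[OF M] mod_homD(1)[OF h x] x by simp
    moreover have "smile_dual R E \<alpha> N \<subseteq> carrier N" using sm[OF N] by blast
    ultimately have "x \<in> smile_dual R E \<alpha> N" using inj_on_image_mem_iff[OF h_inj x] by blast
    thus "t x = \<zero>\<^bsub>E\<^esub>" using sm[OF N] t by blast
  qed
qed

text \<open>Members of the dual class are only isomorphic to duals. Conjugating \<pi> with the
  isomorphisms \<open>a\<close> and \<open>b\<close> gives a surjection of duals, and isomorphisms
  carry \<alpha>-parts onto \<alpha>-parts.\<close>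

lemma cohereditary_dual_classI:
  assumes E: "module R E" and C: "\<And>M. M \<in> C \<Longrightarrow> module R M"
    and \<alpha>: "preradical R (dual_class R E C) \<alpha>"
    and img: "\<And>M N \<pi>. M \<in> C \<Longrightarrow> N \<in> C \<Longrightarrow> \<pi> \<in> mod_hom R (dual R E M) (dual R E N) \<Longrightarrow>
      \<pi> ` carrier (dual R E M) = carrier (dual R E N) \<Longrightarrow> \<pi> ` \<alpha> (dual R E M) = \<alpha> (dual R E N)"
  shows "cohereditary R (dual_class R E C) \<alpha>"
proof -
  have "\<pi> ` \<alpha> A = \<alpha> B"
    if A: "A \<in> dual_class R E C" and B: "B \<in> dual_class R E C"
      and \<pi>: "\<pi> \<in> mod_hom R A B" and surj: "\<pi> ` carrier A = carrier B" for A B \<pi>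
  proof -
    obtain M a where M: "M \<in> C" and a: "a \<in> mod_hom R (dual R E M) A"
      "bij_betw a (carrier (dual R E M)) (carrier A)"
      using A by (auto simp: dual_class_def mod_iso_def)
    obtain N b where N: "N \<in> C" and b: "b \<in> mod_hom R (dual R E N) B"
      "bij_betw b (carrier (dual R E N)) (carrier B)"
      using B by (auto simp: dual_class_def mod_iso_def)
    let ?D = "dual R E M" and ?D' = "dual R E N"
    let ?b' = "inv_into (carrier ?D') b"
    have dc: "?D \<in> dual_class R E C" "?D' \<in> dual_class R E C"
      using dual_in_dual_class M N C E by blast+
    have D: "module R ?D" "module R ?D'" using dual_module M N C E by blast+
    have b': "?b' \<in> mod_hom R B ?D'" by (rule mod_hom_inv_into[OF D(2) b])
    let ?\<pi> = "\<lambda>f. ?b' (\<pi> (a f))"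
    have "?\<pi> ` carrier ?D = ?b' ` \<pi> ` a ` carrier ?D" by (simp add: image_image)
    also have "\<dots> = carrier ?D'"
      using a(2) surj bij_betw_inv_into[OF b(2)] by (simp add: bij_betw_def)
    finally have "?\<pi> ` \<alpha> ?D = \<alpha> ?D'"
      by (intro img[OF M N mod_hom_compose[OF mod_hom_compose[OF a(1) \<pi>] b']])
    moreover have a_img: "a ` \<alpha> ?D = \<alpha> A" by (rule preradical_image_iso[OF \<alpha> dc(1) A D(1) a])
    moreover have "b ` \<alpha> ?D' = \<alpha> B" by (rule preradical_image_iso[OF \<alpha> dc(2) B D(2) b])
    ultimately have "\<alpha> B = b ` ?b' ` \<pi> ` \<alpha> A" by (simp add: image_image flip: a_img)
    also have "\<dots> = \<pi> ` \<alpha> A"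
    proof -
      \<comment> \<open>\<open>b\<close> and its inverse cancel only on \<open>carrier B\<close>, so
        the image has to be placed there first.\<close>
      have "\<pi> ` \<alpha> A \<subseteq> carrier B"
        using \<alpha> A surj submodule_subset by (fastforce simp: preradical_def)
      hence "b (?b' y) = y" if "y \<in> \<pi> ` \<alpha> A" for y
        using that bij_betw_inv_into_right[OF b(2)] by blast
      thus ?thesis by (simp add: image_image)
    qed
    finally show ?thesis by simp
  qed
  thus ?thesis using \<alpha> by (simp add: cohereditary_def)
qed

theorem proposition6p5:
  fixes R :: "('r, 'z) ring_scheme"
    and E :: "('r, 'e) module"
    and \<M> :: "('r, 'm) module set"
    and \<alpha> :: "('r, 'm \<Rightarrow> 'e) module \<Rightarrow> ('m \<Rightarrow> 'e) set"
  assumes "complete_local_noetherian_ring R"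
    and "injective_hull R (residue_field_module R) E"
    and "\<And>M. M \<in> \<M> \<Longrightarrow> matlis_dualizable R E M"
    and "iso_closed R \<M>" and "submodule_closed R \<M>" and "quotient_closed R \<M>"
    and "preradical R (dual_class R E \<M>) \<alpha>"
  shows "hereditary R \<M> (smile_dual R E \<alpha>) \<longleftrightarrow> cohereditary R (dual_class R E \<M>) \<alpha>"
proof
  have R: "noetherian_ring R" "local_ring R"
    using assms(1) by (auto simp: complete_local_noetherian_ring_def)
  have inj: "injective_module R E" using assms(2) by (simp add: injective_hull_def)
  hence E: "module R E" by (simp add: injective_module_def)
  have M: "module R M" if "M \<in> \<M>" for M by (rule matlis_dualizable_module[OF assms(3)[OF that]])
  show "cohereditary R (dual_class R E \<M>) \<alpha>" if "hereditary R \<M> (smile_dual R E \<alpha>)"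
    by (rule cohereditary_dual_classI[OF E M assms(7)
          hereditary_smile_dual_image[OF R assms(2,3,5,7) that]])
  show "hereditary R \<M> (smile_dual R E \<alpha>)" if "cohereditary R (dual_class R E \<M>) \<alpha>"
    by (rule cohereditary_imp_hereditary_smile_dual[OF inj M that])
qed

end
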